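(* Let $(f,X,\mu)$ be a conservative, ergodic dynamical system on a metric space $X$ preserving a $\sigma$-finite measure $\mu$ with $\mu(X)=\infty$. Let $(f_Y,Y,\mu_Y)$ be the induced system over a domain $Y\subseteq X$ of finite positive measure, preserving a probability measure $\mu_Y=\mu|_Y$, with return time function $R\colon Y\to\mathbb{N}$. Suppose $R$ has regular suplevels (with respect to $(Y,\mu_Y)$) with associated exponent $\alpha_R$, and that $(f_Y,Y,\mu_Y)$ satisfies condition (SPDC). Let $\phi\colon X\to[0,\infty)$ be a function which is not bounded, such that $\phi|_{X\setminus Y}$ is bounded, and suppose that $\phi$ also has regular suplevels (with respect to $(X,\mu)$), with associated exponent $\alpha_\phi$. Then $$\lim_{n\to\infty}\frac{\log M_n(x)}{\log n}=\frac{\alpha_R}{\alpha_\phi}$$ holds for $\mu$-a.e. $x\in X$, where $M_n(x)=\max_{0\le k\le n-1}\phi(f^k(x))$.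
   Context: Induced system: $R(x)=\min\{n>0:f^n(x)\in Y\}$ for $x\in Y$, and $f_Y(x)=f^{R(x)}(x)$. Regular suplevels of an unbounded function $\phi\colon Z\to[0,\infty)$ on a metric space $Z$ with measure $m$: put $A_n=\{x\in Z:\phi(x)\ge n\}$. Then (i) $\lim_{n\to\infty}m(A_n)=0$; there is a constant $c>0$ such that $m(A_{n+1})>c\,m(A_n)$ eventually as $n$ increases; and there is $\alpha_\phi\in[0,\infty)$ (the associated exponent) with $\alpha_\phi=\lim_{n\to\infty}\frac{\log m(A_n)}{-\log n}$; (ii) there are $\beta\ge0$ and a Lipschitz function $\tilde\phi\colon Z\to\mathbb{R}^+$ such that $A_n=\{x\in Z:\tilde\phi(x)\le(m(A_n))^\beta\}$. Condition (SPDC) (super-polynomial decay of correlations) for a probability preserving system $(T,Z,m)$ on a metric space: there is a rate function $\Theta(n)$ with $\lim_{n\to\infty}n^{a}\Theta(n)=0$ for every $a>0$ such that for all Lipschitz continuous $\varphi,\psi\colon Z\to\mathbb{R}$, $\left|\int\varphi\circ T^n\,\psi\,dm-\int\varphi\,dm\int\psi\,dm\right|\le\|\varphi\|\|\psi\|\Theta(n)$, where $\|\cdot\|$ is the norm on the Banach space of Lipschitz functions.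
   Formalization: The case where both associated exponents are zero is excluded, since the quotient of the exponents is then 0/0 and undefined; when only the exponent of φ is zero, the limit is read as +∞. *)

theory Defs
  imports "HOL-Probability.Probability"
begin

definition measure_preserving_map :: "'a measure \<Rightarrow> ('a \<Rightarrow> 'a) \<Rightarrow> bool" where
  "measure_preserving_map M T \<longleftrightarrow> T \<in> M \<rightarrow>\<^sub>M M \<and> distr M M T = M"

definition ergodic :: "'a measure \<Rightarrow> ('a \<Rightarrow> 'a) \<Rightarrow> bool" where
  "ergodic M T \<longleftrightarrow>
    (\<forall>A\<in>sets M. T -` A \<inter> space M = A \<longrightarrow> A \<in> null_sets M \<or> space M - A \<in> null_sets M)"

text \<open>Every measurable wandering set is a null set.\<close>

definition conservative :: "'a measure \<Rightarrow> ('a \<Rightarrow> 'a) \<Rightarrow> bool" where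
  "conservative M T \<longleftrightarrow>
    (\<forall>W\<in>sets M. disjoint_family (\<lambda>n. (T ^^ n) -` W \<inter> space M) \<longrightarrow> emeasure M W = 0)"

text \<open>
  On the natural numbers \<open>Inf {} = 0\<close>. Hence a point that never returns to \<open>Y\<close> has return time
  \<open>0\<close> and is fixed by the induced map. For a conservative measure preserving map
  such points of \<open>Y\<close> form a null set.
\<close>

definition return_time :: "('a \<Rightarrow> 'a) \<Rightarrow> 'a set \<Rightarrow> 'a \<Rightarrow> nat" where
  "return_time f Y x = Inf {n. n > 0 \<and> (f ^^ n) x \<in> Y}"

definition induced_map :: "('a \<Rightarrow> 'a) \<Rightarrow> 'a set \<Rightarrow> 'a \<Rightarrow> 'a" where
  "induced_map f Y x = (f ^^ return_time f Y x) x"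

text \<open>
  The restriction of \<open>M\<close> to \<open>Y\<close>, as a measure with space \<open>Y\<close>, normalized to total mass 1.
  It is the plain restriction if \<open>Y\<close> has measure 1.
\<close>

definition induced_measure :: "'a measure \<Rightarrow> 'a set \<Rightarrow> 'a measure" where
  "induced_measure M Y = restrict_space (uniform_measure M Y) Y"

definition suplevel :: "'a measure \<Rightarrow> ('a \<Rightarrow> real) \<Rightarrow> nat \<Rightarrow> 'a set" where
  "suplevel m \<phi> n = {x \<in> space m. \<phi> x \<ge> real n}"

text \<open>
  \<open>\<alpha>\<close> is the associated exponent. The measure \<open>m\<close> may be infinite (then \<open>suplevel m \<phi> 0\<close> has
  infinite measure), so convergence to 0 is stated for \<open>emeasure\<close>. The conditions formulated with
  the real-valued \<open>measure\<close> only concern suplevels of finite measure: the ones in part (i) because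
  they are asymptotic, part (ii) by its explicit guard.
\<close>

definition regular_suplevels ::
    "'a::metric_space measure \<Rightarrow> ('a \<Rightarrow> real) \<Rightarrow> real \<Rightarrow> bool" where
  "regular_suplevels m \<phi> \<alpha> \<longleftrightarrow>
    (\<forall>x\<in>space m. 0 \<le> \<phi> x) \<and> \<not> bdd_above (\<phi> ` space m) \<and>
    (\<forall>n. suplevel m \<phi> n \<in> sets m) \<and>
    (\<lambda>n. emeasure m (suplevel m \<phi> n)) \<longlonglongrightarrow> 0 \<and>
    (\<exists>c>0. \<forall>\<^sub>F n in sequentially.
        measure m (suplevel m \<phi> (Suc n)) > c * measure m (suplevel m \<phi> n)) \<and>
    0 \<le> \<alpha> \<and>
    (\<lambda>n. ln (measure m (suplevel m \<phi> n)) / (- ln (real n))) \<longlonglongrightarrow> \<alpha> \<and>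
    (\<exists>\<beta>\<ge>0. \<exists>\<psi>. (\<exists>L. L-lipschitz_on (space m) \<psi>) \<and> (\<forall>x\<in>space m. 0 \<le> \<psi> x) \<and>
        (\<forall>n. emeasure m (suplevel m \<phi> n) < \<infinity> \<longrightarrow>
             suplevel m \<phi> n = {x \<in> space m. \<psi> x \<le> measure m (suplevel m \<phi> n) powr \<beta>}))"

text \<open>The Banach space of Lipschitz functions on \<open>Z\<close> consists of the bounded ones.\<close>

definition bounded_lipschitz_on :: "'a::metric_space set \<Rightarrow> ('a \<Rightarrow> real) \<Rightarrow> bool" where
  "bounded_lipschitz_on Z g \<longleftrightarrow> bounded (g ` Z) \<and> (\<exists>L. L-lipschitz_on Z g)"

definition lipschitz_norm :: "'a::metric_space set \<Rightarrow> ('a \<Rightarrow> real) \<Rightarrow> real" where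
  "lipschitz_norm Z g = (SUP x\<in>Z. \<bar>g x\<bar>) + Inf {L. L-lipschitz_on Z g}"

definition SPDC :: "'a::metric_space measure \<Rightarrow> ('a \<Rightarrow> 'a) \<Rightarrow> bool" where
  "SPDC m T \<longleftrightarrow>
    (\<exists>\<Theta> :: nat \<Rightarrow> real.
      (\<forall>a>0. (\<lambda>n. real n powr a * \<Theta> n) \<longlonglongrightarrow> 0) \<and>
      (\<forall>g h. bounded_lipschitz_on (space m) g \<longrightarrow> bounded_lipschitz_on (space m) h \<longrightarrow>
        (\<forall>n. \<bar>(\<integral>x. g ((T ^^ n) x) * h x \<partial>m) - (\<integral>x. g x \<partial>m) * (\<integral>x. h x \<partial>m)\<bar>
              \<le> lipschitz_norm (space m) g * lipschitz_norm (space m) h * \<Theta> n)))"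

definition running_max :: "('a \<Rightarrow> 'a) \<Rightarrow> ('a \<Rightarrow> real) \<Rightarrow> nat \<Rightarrow> 'a \<Rightarrow> real" where
  "running_max f \<phi> n x = Max ((\<lambda>k. \<phi> ((f ^^ k) x)) ` {..<n})"

end

theory Submission
  imports Defs
begin


text \<open>
  Write \<open>\<nu>\<close> for the normalized measure on \<open>Y\<close>, \<open>T\<close> for the induced map and
  \<open>S\<^sub>j(x)\<close> for the sum of the first \<open>j\<close> return times along the \<open>T\<close>-orbit of \<open>x\<close>. Since \<open>\<phi>\<close> is
  bounded outside \<open>Y\<close>, the maximum of \<open>\<phi>\<close> up to time \<open>n\<close> is, up to a constant, the maximum of \<open>\<phi>\<close>
  over the first \<open>N\<close> points of the \<open>T\<close>-orbit, where \<open>N\<close> is the number of visits to \<open>Y\<close> up to time \<open>n\<close>,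
  that is \<open>S\<^sub>N\<close> is about \<open>n\<close>. So the exponent factors into the growth exponent of \<open>\<phi>\<close> along \<open>T\<close>,
  which is \<open>1/\<alpha>\<^sub>\<phi>\<close>, and the growth exponent of \<open>N\<close>, which is \<open>\<alpha>\<^sub>R\<close>.
\<close>

text \<open>
  Two of the four bounds behind this follow from the invariance of \<open>\<nu>\<close> and the measures of the suplevels. The bound
  \<open>\<phi>(T\<^sup>j x) < j\<^sup>s\<close> for \<open>s > 1/\<alpha>\<^sub>\<phi>\<close> is the first Borel-Cantelli lemma
  (\<open>suplevels_avoided_eventually\<close>). For \<open>p < \<alpha>\<^sub>R \<le> 1\<close> the variable \<open>R\<^sup>p\<close> is integrable and
  \<open>S\<^sub>n\<^sup>p \<le> \<Sum>\<^sub>k\<^sub><\<^sub>n R(T\<^sup>k x)\<^sup>p\<close>, which gives \<open>S\<^sub>n = O(n\<^sup>u)\<close> for \<open>u > 1/\<alpha>\<^sub>R\<close>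
  (\<open>Birkhoff_sum_growth\<close>). Here \<open>\<alpha>\<^sub>R \<le> 1\<close> is forced by the infinite total mass: by Kac's formula the mean
  return time is infinite (\<open>return_exponent_le_1\<close>).
\<close>

text \<open>
  The other two bounds say that \<open>\<phi>\<close>, respectively \<open>R\<close>, is large often enough: its maximum over \<open>n\<close> steps of
  \<open>T\<close> is at least \<open>n\<^sup>s\<close> eventually, for \<open>s\<close> below the reciprocal exponent
  (\<open>suplevels_hit_eventually\<close>). For \<open>R\<close> this bounds \<open>S\<^sub>n\<close> from below, since a sum dominates its maximum.
  This is where the decay of correlations enters. Regularity lets a suplevel be approximated from inside
  by a Lipschitz function whose norm is polynomial in the inverse of its measure. Sampling the orbit at times
  \<open>q i\<close> with \<open>i < q\<^sup>r\<^sup>-\<^sup>1\<close> leaves gaps of length \<open>q\<close>, over which super-polynomial decay beats those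
  norms, so the samples are nearly uncorrelated and Chebyshev's inequality bounds the probability of missing
  the suplevel by \<open>O(q\<^sup>-\<^sup>2)\<close>. The sum over \<open>q\<close> converges, and the times \<open>q\<^sup>r\<close> are dense enough
  to cover all \<open>n\<close>.
\<close>

section \<open>Measure-preserving maps\<close>

lemma measure_preserving_funpow:
  assumes "measure_preserving_map M T"
  shows "measure_preserving_map M (T ^^ n)"
proof (induction n)
  case 0
  show ?case by (simp add: measure_preserving_map_def distr_id)
next
  case (Suc n)
  then show ?case
    using assms distr_distr[of T M M "T ^^ n" M]
    by (auto simp: measure_preserving_map_def measurable_comp comp_def)
qed

lemma measure_preserving_integral:
  fixes g :: "'a \<Rightarrow> real"
  assumes "measure_preserving_map M T" "g \<in> borel_measurable M"
  shows "(\<integral>x. g (T x) \<partial>M) = (\<integral>x. g x \<partial>M)"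
  using integral_distr[of T M M g] assms by (simp add: measure_preserving_map_def)

lemma measure_preserving_nn_integral:
  assumes "measure_preserving_map M T" "g \<in> borel_measurable M"
  shows "(\<integral>\<^sup>+x. g (T x) \<partial>M) = (\<integral>\<^sup>+x. g x \<partial>M)"
  using nn_integral_distr[of T M M g] assms by (simp add: measure_preserving_map_def)

lemma measure_preserving_emeasure:
  assumes "measure_preserving_map M T" "A \<in> sets M"
  shows "emeasure M (T -` A \<inter> space M) = emeasure M A"
  using emeasure_distr[of T M M A] assms by (simp add: measure_preserving_map_def)

lemma measure_preserving_AE:
  assumes "measure_preserving_map M T" "AE x in M. P x"
  shows "AE x in M. P (T x)"
  using AE_distrD[of T M M P] assms unfolding measure_preserving_map_def by metis

section \<open>Hitting suplevels under decay of correlations\<close>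

text \<open>
  If \<open>h\<close> vanishes at all \<open>N\<close> samples, the sum of the samples misses its mean \<open>N E h\<close> by \<open>N E h\<close>, so
  Chebyshev's inequality applies. In the variance of the sum each of the \<open>N\<close> diagonal terms is at most
  \<open>E h\<close>, because \<open>h\<^sup>2 \<le> h\<close>, and the others are correlations over gaps of length at least \<open>q\<close>.
\<close>

lemma (in prob_space) avoidance_probability:
  fixes h :: "'a \<Rightarrow> real"
  assumes T: "measure_preserving_map M T" and h[measurable]: "h \<in> borel_measurable M"
    and h01: "\<And>x. x \<in> space M \<Longrightarrow> 0 \<le> h x \<and> h x \<le> 1"
    and p: "0 < expectation h"
    and cov: "\<And>l. q \<le> l \<Longrightarrow>
      \<bar>expectation (\<lambda>x. h ((T ^^ l) x) * h x) - (expectation h)\<^sup>2\<bar> \<le> D"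
    and q: "q > 0" and N: "N > 0"
  shows "prob {x \<in> space M. \<forall>i<N. h ((T ^^ (q * i)) x) = 0}
    \<le> 1 / (real N * expectation h) + D / (expectation h)\<^sup>2"
proof -
  define p where "p = expectation h"
  define X where "X = (\<lambda>i x. h ((T ^^ (q * i)) x))"
  define Z where "Z = (\<lambda>x. \<Sum>i<N. X i x - p)"
  have Tn[measurable]: "(T ^^ n) \<in> M \<rightarrow>\<^sub>M M" for n
    using measure_preserving_funpow[OF T] by (simp add: measure_preserving_map_def)
  have Tsp: "(T ^^ n) x \<in> space M" if "x \<in> space M" for n x
    using measurable_space[OF Tn that] .
  have X[measurable]: "X i \<in> borel_measurable M" for i
    unfolding X_def by measurable
  have X01: "0 \<le> X i x \<and> X i x \<le> 1" if "x \<in> space M" for i x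
    unfolding X_def using h01 Tsp that by blast
  have bdd: "integrable M u" if "u \<in> borel_measurable M" "\<And>x. x \<in> space M \<Longrightarrow> \<bar>u x\<bar> \<le> 1" for u :: "'a \<Rightarrow> real"
    by (rule integrable_const_bound[where B=1]) (use that in auto)
  have iX: "integrable M (X i)" for i
    using X01 by (intro bdd) auto
  have iXX: "integrable M (\<lambda>x. X i x * X j x)" for i j
    using X01 by (intro bdd) (auto simp: abs_mult intro!: mult_le_one)
  have EX: "expectation (X i) = p" for i
    unfolding X_def p_def
    by (rule measure_preserving_integral[OF measure_preserving_funpow[OF T] h])
  have D0: "0 \<le> D" using cov[of q] by linarith
  have far: "expectation (\<lambda>x. X i x * X j x) - p\<^sup>2 \<le> D" if "i < j" for i j
  proof -
    have "X i x * X j x = (\<lambda>y. h ((T ^^ (q * (j - i))) y) * h y) ((T ^^ (q * i)) x)" for x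
    proof -
      have "q * j = q * (j - i) + q * i" using that by (simp add: diff_mult_distrib2)
      then show ?thesis unfolding X_def by (simp add: funpow_add)
    qed
    then have "expectation (\<lambda>x. X i x * X j x) = expectation (\<lambda>y. h ((T ^^ (q * (j - i))) y) * h y)"
      using measure_preserving_integral[OF measure_preserving_funpow[OF T, of "q * i"],
          of "\<lambda>y. h ((T ^^ (q * (j - i))) y) * h y"] by simp
    moreover have "q \<le> q * (j - i)" using that by (simp add: Suc_le_eq)
    ultimately show ?thesis using cov[of "q * (j - i)"] unfolding p_def by linarith
  qed
  have pair: "expectation (\<lambda>x. (X i x - p) * (X j x - p)) \<le> (if i = j then p else 0) + D" for i j
  proof -
    have "(\<lambda>x. (X i x - p) * (X j x - p)) = (\<lambda>x. X i x * X j x - p * X i x - p * X j x + p\<^sup>2)"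
      by (auto simp: algebra_simps power2_eq_square)
    then have eq: "expectation (\<lambda>x. (X i x - p) * (X j x - p)) = expectation (\<lambda>x. X i x * X j x) - p\<^sup>2"
      using iX iXX EX by (simp add: prob_space power2_eq_square)
    consider "i = j" | "i < j" | "j < i" by linarith
    then show ?thesis
    proof cases
      case 1
      have "expectation (\<lambda>x. X i x * X j x) \<le> expectation (X i)"
        using X01 1 by (intro integral_mono[OF iXX iX]) (simp add: mult_left_le)
      then show ?thesis using eq EX[of i] 1 D0 by (simp add: zero_le_power2) (smt (verit) zero_le_power2)
    next
      case 2
      then show ?thesis using far eq by auto
    next
      case 3
      then show ?thesis using far[of j i] eq by (auto simp: mult.commute)
    qed
  qed
  have iXp: "integrable M (\<lambda>x. (X i x - p) * (X j x - p))" for i j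
  proof -
    have "(\<lambda>x. (X i x - p) * (X j x - p)) = (\<lambda>x. X i x * X j x - p * X i x - p * X j x + p\<^sup>2)"
      by (auto simp: algebra_simps power2_eq_square)
    then show ?thesis using iX iXX by simp
  qed
  have Z2: "(Z x)\<^sup>2 = (\<Sum>i<N. \<Sum>j<N. (X i x - p) * (X j x - p))" for x
    unfolding Z_def power2_eq_square by (simp add: sum_product)
  have "expectation (\<lambda>x. (Z x)\<^sup>2) = (\<Sum>i<N. \<Sum>j<N. expectation (\<lambda>x. (X i x - p) * (X j x - p)))"
    unfolding Z2 using iXp by (simp add: Bochner_Integration.integral_sum)
  also have "\<dots> \<le> (\<Sum>i<N. \<Sum>j<N. (if i = j then p else 0) + D)"
    by (intro sum_mono pair)
  also have "\<dots> = real N * p + (real N)\<^sup>2 * D"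
    by (simp add: sum.distrib power2_eq_square algebra_simps)
  finally have var: "expectation (\<lambda>x. (Z x)\<^sup>2) \<le> real N * p + (real N)\<^sup>2 * D" .
  have iZ: "integrable M (\<lambda>x. (Z x)\<^sup>2)"
    unfolding Z2 using iXp by simp
  have pos: "0 < real N * p" using N assms(4) by (simp add: p_def)
  have Zm[measurable]: "Z \<in> borel_measurable M" unfolding Z_def by measurable
  have "prob {x \<in> space M. \<forall>i<N. h ((T ^^ (q * i)) x) = 0} \<le> prob {x \<in> space M. (Z x)\<^sup>2 \<ge> (real N * p)\<^sup>2}"
    by (intro finite_measure_mono) (auto simp: Z_def X_def power2_eq_square)
  also have "\<dots> \<le> expectation (\<lambda>x. (Z x)\<^sup>2) / (real N * p)\<^sup>2"
    using integral_Markov_inequality_measure[OF iZ, of "{}" "(real N * p)\<^sup>2"] pos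
    by (auto simp: zero_less_mult_iff)
  also have "\<dots> \<le> (real N * p + (real N)\<^sup>2 * D) / (real N * p)\<^sup>2"
    using var by (intro divide_right_mono) auto
  also have "\<dots> = 1 / (real N * p) + D / p\<^sup>2"
    using N assms(4) unfolding p_def[symmetric] by (simp add: field_simps power2_eq_square)
  finally show ?thesis by (simp add: p_def)
qed

lemma lipschitz_bump:
  fixes \<psi> :: "'a::metric_space \<Rightarrow> real"
  assumes "L-lipschitz_on Z \<psi>" "a < b"
  shows "(L / (b - a))-lipschitz_on Z (\<lambda>x. max 0 (min 1 ((b - \<psi> x) / (b - a))))"
proof (rule lipschitz_onI)
  show "0 \<le> L / (b - a)" using lipschitz_on_nonneg[OF assms(1)] assms(2) by simp
  fix x y assume "x \<in> Z" "y \<in> Z"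
  have "dist (max 0 (min 1 ((b - \<psi> x) / (b - a)))) (max 0 (min 1 ((b - \<psi> y) / (b - a))))
     \<le> \<bar>(b - \<psi> x) / (b - a) - (b - \<psi> y) / (b - a)\<bar>"
    unfolding dist_real_def by linarith
  also have "\<dots> = \<bar>\<psi> x - \<psi> y\<bar> / (b - a)"
    using assms(2) by (simp add: abs_minus_commute abs_divide flip: diff_divide_distrib)
  also have "\<dots> \<le> (L * dist x y) / (b - a)"
    using lipschitz_onD[OF assms(1) \<open>x \<in> Z\<close> \<open>y \<in> Z\<close>] assms(2)
    by (intro divide_right_mono) (auto simp: dist_real_def)
  finally show "dist (max 0 (min 1 ((b - \<psi> x) / (b - a)))) (max 0 (min 1 ((b - \<psi> y) / (b - a))))
     \<le> L / (b - a) * dist x y" by simp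
qed

lemma lipschitz_norm_le:
  assumes "Z \<noteq> {}" "L-lipschitz_on Z h" "\<And>x. x \<in> Z \<Longrightarrow> \<bar>h x\<bar> \<le> B"
  shows "lipschitz_norm Z h \<le> B + L"
  unfolding lipschitz_norm_def
proof (rule add_mono)
  show "(SUP x\<in>Z. \<bar>h x\<bar>) \<le> B" using assms by (intro cSUP_least) auto
  show "Inf {L. L-lipschitz_on Z h} \<le> L"
    using assms(2) by (intro cInf_lower) (auto intro!: bdd_belowI[of _ 0] dest: lipschitz_on_nonneg)
qed

lemma lipschitz_norm_nonneg:
  assumes "Z \<noteq> {}" "L-lipschitz_on Z h" "\<And>x. x \<in> Z \<Longrightarrow> \<bar>h x\<bar> \<le> B"
  shows "0 \<le> lipschitz_norm Z h"
  unfolding lipschitz_norm_def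
proof (rule add_nonneg_nonneg)
  obtain z where "z \<in> Z" using assms(1) by auto
  have "\<bar>h z\<bar> \<le> (SUP x\<in>Z. \<bar>h x\<bar>)"
    using assms \<open>z \<in> Z\<close> by (intro cSUP_upper) (auto intro!: bdd_aboveI2)
  then show "0 \<le> (SUP x\<in>Z. \<bar>h x\<bar>)" by linarith
  show "0 \<le> Inf {L. L-lipschitz_on Z h}"
    using assms(2) by (intro cInf_greatest) (auto dest: lipschitz_on_nonneg)
qed


text \<open>
  The asymptotic content of regular suplevels. Unlike \<open>regular_suplevels\<close>, it passes from the
  infinite measure space to its induced system, where the suplevels of low level are cut down to \<open>Y\<close> and
  only those of high level keep their form.
\<close>

definition asymptotically_regular ::
    "'a::metric_space measure \<Rightarrow> ('a \<Rightarrow> real) \<Rightarrow> real \<Rightarrow> bool" where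
  "asymptotically_regular m \<phi> \<alpha> \<longleftrightarrow>
    (\<forall>n. suplevel m \<phi> n \<in> sets m) \<and>
    (\<lambda>n. measure m (suplevel m \<phi> n)) \<longlonglongrightarrow> 0 \<and>
    (\<exists>c>0. \<forall>\<^sub>F n in sequentially.
        measure m (suplevel m \<phi> (Suc n)) > c * measure m (suplevel m \<phi> n)) \<and>
    (\<lambda>n. ln (measure m (suplevel m \<phi> n)) / (- ln (real n))) \<longlonglongrightarrow> \<alpha> \<and>
    (\<exists>\<beta>\<ge>0. \<exists>\<psi>. (\<exists>L. L-lipschitz_on (space m) \<psi>) \<and>
        (\<forall>\<^sub>F n in sequentially.
             suplevel m \<phi> n = {x \<in> space m. \<psi> x \<le> measure m (suplevel m \<phi> n) powr \<beta>}))"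

lemma asymptotically_regular_pos:
  assumes "asymptotically_regular m \<phi> \<alpha>"
  shows "\<forall>\<^sub>F n in sequentially. 0 < measure m (suplevel m \<phi> n)"
proof -
  obtain c where "c > 0" "\<forall>\<^sub>F n in sequentially.
        measure m (suplevel m \<phi> (Suc n)) > c * measure m (suplevel m \<phi> n)"
    using assms unfolding asymptotically_regular_def by blast
  then have "\<forall>\<^sub>F n in sequentially. 0 < measure m (suplevel m \<phi> (Suc n))"
    by (elim eventually_mono) (meson less_eq_real_def measure_nonneg mult_nonneg_nonneg order_le_less_trans)
  then show ?thesis by (subst (asm) eventually_sequentially_Suc)
qed

lemma suplevel_antimono: "n \<le> k \<Longrightarrow> suplevel m \<phi> k \<subseteq> suplevel m \<phi> n"
  by (force simp: suplevel_def)

lemma asymptotically_regular_lower: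
  assumes "asymptotically_regular m \<phi> \<alpha>" "\<alpha> < a"
  shows "\<forall>\<^sub>F n in sequentially. real n powr (- a) < measure m (suplevel m \<phi> n)"
proof -
  have "\<forall>\<^sub>F n in sequentially. ln (measure m (suplevel m \<phi> n)) / (- ln (real n)) < a"
    using assms by (auto simp: asymptotically_regular_def intro: order_tendstoD)
  then show ?thesis using asymptotically_regular_pos[OF assms(1)] eventually_gt_at_top[of 1]
  proof eventually_elim
    case (elim n)
    then have "- a * ln (real n) < ln (measure m (suplevel m \<phi> n))"
      by (simp add: field_simps)
    then have "exp (- a * ln (real n)) < exp (ln (measure m (suplevel m \<phi> n)))"
      by (simp only: exp_less_cancel_iff)
    then show ?case using elim by (simp add: powr_def)
  qed
qed

lemma asymptotically_regular_upper:
  assumes "asymptotically_regular m \<phi> \<alpha>" "a < \<alpha>"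
  shows "\<forall>\<^sub>F n in sequentially. measure m (suplevel m \<phi> n) < real n powr (- a)"
proof -
  have "\<forall>\<^sub>F n in sequentially. ln (measure m (suplevel m \<phi> n)) / (- ln (real n)) > a"
    using assms by (auto simp: asymptotically_regular_def intro: order_tendstoD)
  then show ?thesis using asymptotically_regular_pos[OF assms(1)] eventually_gt_at_top[of 1]
  proof eventually_elim
    case (elim n)
    then have "- a * ln (real n) > ln (measure m (suplevel m \<phi> n))"
      by (simp add: field_simps)
    then have "exp (- a * ln (real n)) > exp (ln (measure m (suplevel m \<phi> n)))"
      by (simp only: exp_less_cancel_iff)
    then show ?case using elim by (simp add: powr_def)
  qed
qed

text \<open>
  The bump function is 1 on a deeper suplevel \<open>A\<^sub>k\<^sub>'\<close> and 0 outside \<open>A\<^sub>k\<close>. The index \<open>k'\<close> is the first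
  one at which the measure has halved: halving separates the two thresholds of \<open>\<psi>\<close> by a fixed
  proportion of \<open>m(A\<^sub>k)\<^sup>\<beta>\<close>, which bounds the Lipschitz constant by a multiple of \<open>m(A\<^sub>k)\<^sup>-\<^sup>\<beta>\<close>, while the
  condition \<open>m(A\<^sub>n\<^sub>+\<^sub>1) > c m(A\<^sub>n)\<close> prevents the measure from dropping much below one half, so the mean
  of the bump is comparable to \<open>m(A\<^sub>k)\<close>.
\<close>

lemma suplevel_avoidance_probability:
  fixes m :: "'a::metric_space measure" and \<Theta> :: "nat \<Rightarrow> real"
  assumes "prob_space m"
    and T: "measure_preserving_map m T"
    and cont: "\<And>u :: 'a \<Rightarrow> real. continuous_on (space m) u \<Longrightarrow> u \<in> borel_measurable m"
    and decay: "\<And>g h n. bounded_lipschitz_on (space m) g \<Longrightarrow> bounded_lipschitz_on (space m) h \<Longrightarrow>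
        \<bar>(\<integral>x. g ((T ^^ n) x) * h x \<partial>m) - (\<integral>x. g x \<partial>m) * (\<integral>x. h x \<partial>m)\<bar>
              \<le> lipschitz_norm (space m) g * lipschitz_norm (space m) h * \<Theta> n"
    and reg: "asymptotically_regular m \<phi> \<alpha>"
  shows "\<exists>C>0. \<exists>e>0. \<forall>\<^sub>F k in sequentially. \<forall>q>0. \<forall>N>0. \<forall>D. (\<forall>l\<ge>q. \<Theta> l \<le> D) \<longrightarrow> 0 \<le> D \<longrightarrow>
    measure m {x \<in> space m. \<forall>i<N. (T ^^ (q * i)) x \<notin> suplevel m \<phi> k}
      \<le> C / (real N * measure m (suplevel m \<phi> k)) + C * D * measure m (suplevel m \<phi> k) powr (- e)"
proof -
  interpret prob_space m by fact
  let ?m = "\<lambda>k. measure m (suplevel m \<phi> k)"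
  note reg' = reg[unfolded asymptotically_regular_def]
  have A[measurable]: "suplevel m \<phi> n \<in> sets m" for n using reg' by blast
  have m0: "?m \<longlonglongrightarrow> 0" using reg' by blast
  have mono: "n \<le> k \<Longrightarrow> ?m k \<le> ?m n" for n k
    by (intro finite_measure_mono suplevel_antimono) auto
  obtain c where c: "c > 0" "\<forall>\<^sub>F n in sequentially. c * ?m n < ?m (Suc n)" using reg' by blast
  obtain n1 where n1: "\<And>n. n \<ge> n1 \<Longrightarrow> c * ?m n < ?m (Suc n)"
    using c(2) by (auto simp: eventually_sequentially)
  obtain n2 where n2: "\<And>n. n \<ge> n2 \<Longrightarrow> 0 < ?m n"
    using asymptotically_regular_pos[OF reg] by (auto simp: eventually_sequentially)
  obtain \<beta> \<psi> L where \<beta>0: "0 \<le> \<beta>" and L: "L-lipschitz_on (space m) \<psi>"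
    and ev: "\<forall>\<^sub>F n in sequentially. suplevel m \<phi> n = {x \<in> space m. \<psi> x \<le> ?m n powr \<beta>}"
    using reg' by blast
  obtain n3 where n3: "\<And>n. n \<ge> n3 \<Longrightarrow> suplevel m \<phi> n = {x \<in> space m. \<psi> x \<le> ?m n powr \<beta>}"
    using ev by (auto simp: eventually_sequentially)
  have small: "\<exists>j. j \<ge> k \<and> ?m j \<le> ?m k / 2" if "k \<ge> n2" for k
  proof -
    have "\<forall>\<^sub>F j in sequentially. ?m j < ?m k / 2"
      using order_tendstoD(2)[OF m0, of "?m k / 2"] n2[OF that] by simp
    then obtain n where "\<And>j. j \<ge> n \<Longrightarrow> ?m j < ?m k / 2"
      by (auto simp: eventually_sequentially)
    then show ?thesis by (intro exI[of _ "max n k"]) (simp add: less_imp_le)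
  qed
  have \<beta>: "0 < \<beta>"
  proof (rule ccontr)
    assume "\<not> 0 < \<beta>"
    then have "\<beta> = 0" using \<beta>0 by simp
    define k where "k = max n2 n3"
    \<comment> \<open>With exponent 0 every threshold would be 1 and the suplevels could not shrink.\<close>
    obtain j where j: "j \<ge> k" "?m j \<le> ?m k / 2" using small[of k] by (auto simp: k_def)
    have "suplevel m \<phi> j = suplevel m \<phi> k"
      using n3[of j] n3[of k] n2[of j] n2[of k] j(1) \<open>\<beta> = 0\<close> by (simp add: k_def)
    then show False using j n2[of k] by (simp add: k_def)
  qed
  define \<rho> where "\<rho> = 1 - (1/2) powr \<beta>"
  have \<rho>: "0 < \<rho>" unfolding \<rho>_def using \<beta> powr_less_mono2[of \<beta> "1/2" 1] by simp
  have L0: "0 \<le> L" using lipschitz_on_nonneg[OF L] .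
  define K where "K = 1 + L / \<rho>"
  have K: "K > 0" unfolding K_def using L0 \<rho> by (simp add: add_pos_nonneg)
  define C where "C = max (2 / c) (K\<^sup>2 * 4 / c\<^sup>2)"
  have C: "C > 0" using c(1) by (simp add: C_def less_max_iff_disj)
  have main: "measure m {x \<in> space m. \<forall>i<N. (T ^^ (q * i)) x \<notin> suplevel m \<phi> k}
      \<le> C / (real N * ?m k) + C * D * ?m k powr (- (2 * \<beta> + 2))"
    if k: "k \<ge> n1" "k \<ge> n2" "k \<ge> n3" and q: "q > 0" and N: "N > 0"
      and D: "\<And>l. l \<ge> q \<Longrightarrow> \<Theta> l \<le> D" "0 \<le> D" for k q N D
  proof -
    have mk: "0 < ?m k" using n2 k by blast
    define k' where "k' = (LEAST j. j \<ge> k \<and> ?m j \<le> ?m k / 2)"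
    have k': "k' \<ge> k" "?m k' \<le> ?m k / 2"
      using LeastI_ex[OF small[OF k(2)]] unfolding k'_def by blast+
    have "k' \<noteq> k" using k'(2) mk by auto
    then have k'1: "k \<le> k' - 1" "k' = Suc (k' - 1)" using k'(1) by linarith+
    have "\<not> (?m (k' - 1) \<le> ?m k / 2)"
      using not_less_Least[of "k' - 1" "\<lambda>j. j \<ge> k \<and> ?m j \<le> ?m k / 2"] k'1 unfolding k'_def[symmetric] by simp
    then have "c * (?m k / 2) < c * ?m (k' - 1)" using c by simp
    also have "\<dots> < ?m k'" using n1[of "k' - 1"] k'1 k by simp
    finally have mk': "c / 2 * ?m k < ?m k'" by simp
    define a where "a = ?m k' powr \<beta>"
    define b where "b = ?m k powr \<beta>"
    have b: "0 < b" using mk by (simp add: b_def)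
    have "a \<le> (?m k / 2) powr \<beta>"
      unfolding a_def using k' \<beta> by (intro powr_mono2) auto
    also have "\<dots> = (1 - \<rho>) * b" by (simp add: \<rho>_def b_def powr_divide)
    finally have ab': "\<rho> * b \<le> b - a" by (simp add: algebra_simps)
    then have ab: "a < b" using \<rho> b by (smt (verit) mult_pos_pos)
    define h where "h = (\<lambda>x. max 0 (min 1 ((b - \<psi> x) / (b - a))))"
    have lip: "(L / (b - a))-lipschitz_on (space m) h"
      unfolding h_def by (rule lipschitz_bump[OF L ab])
    have h01: "0 \<le> h x \<and> h x \<le> 1" for x by (simp add: h_def)
    have hb: "bounded_lipschitz_on (space m) h"
      unfolding bounded_lipschitz_on_def using lip h01
      by (auto intro!: boundedI[where B=1])
    have h[measurable]: "h \<in> borel_measurable m"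
      using cont lipschitz_on_continuous_on[OF lip] by blast
    have "L / (b - a) \<le> L / (\<rho> * b)"
      using ab' \<rho> b L0 ab by (intro divide_left_mono) auto
    moreover have "1 \<le> 1 / b" using b \<beta> by (simp add: b_def powr_le1)
    ultimately have "1 + L / (b - a) \<le> K / b"
      by (simp add: K_def add_divide_distrib)
    then have nh: "lipschitz_norm (space m) h \<le> K / b"
      using lipschitz_norm_le[OF not_empty lip, of 1] h01 by (simp add: abs_of_nonneg)
    have nh0: "0 \<le> lipschitz_norm (space m) h"
      using lipschitz_norm_nonneg[OF not_empty lip, of 1] h01 by (simp add: abs_of_nonneg)
    have "?m k' = expectation (indicator (suplevel m \<phi> k'))" by simp
    also have "\<dots> \<le> expectation h"
    proof (rule integral_mono)
      show "integrable m (indicator (suplevel m \<phi> k') :: 'a \<Rightarrow> real)"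
        by (intro integrable_real_indicator) (auto simp: emeasure_eq_measure)
      show "integrable m h"
        by (rule integrable_const_bound[where B=1]) (use h01 in auto)
      fix x assume "x \<in> space m"
      show "indicator (suplevel m \<phi> k') x \<le> h x"
      proof (cases "x \<in> suplevel m \<phi> k'")
        case True
        moreover have "n3 \<le> k'" using k k' by linarith
        ultimately have "\<psi> x \<le> a" using n3[of k'] unfolding a_def by blast
        then have "h x = 1" using ab by (simp add: h_def)
        then show ?thesis by simp
      qed (use h01 in auto)
    qed
    finally have p: "c / 2 * ?m k \<le> expectation h" using mk' by linarith
    have p0: "0 < c / 2 * ?m k" using c mk by simp
    have p1: "0 < expectation h" using p p0 by linarith
    have cov: "\<bar>expectation (\<lambda>x. h ((T ^^ l) x) * h x) - (expectation h)\<^sup>2\<bar> \<le> (K / b)\<^sup>2 * D" if "q \<le> l" for l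
    proof -
      have "\<bar>expectation (\<lambda>x. h ((T ^^ l) x) * h x) - (expectation h)\<^sup>2\<bar>
        \<le> lipschitz_norm (space m) h * lipschitz_norm (space m) h * \<Theta> l"
        using decay[OF hb hb] by (simp add: power2_eq_square)
      also have "\<dots> \<le> lipschitz_norm (space m) h * lipschitz_norm (space m) h * D"
        using D that nh0 by (intro mult_left_mono) auto
      also have "\<dots> \<le> (K / b)\<^sup>2 * D" unfolding power2_eq_square
        using D nh nh0 by (intro mult_right_mono mult_mono) auto
      finally show ?thesis .
    qed
    have Tn[measurable]: "(T ^^ n) \<in> m \<rightarrow>\<^sub>M m" for n
      using measure_preserving_funpow[OF T] by (simp add: measure_preserving_map_def)
    have hA: "h y = 0" if "y \<in> space m" "y \<notin> suplevel m \<phi> k" for y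
    proof -
      have "b < \<psi> y" using n3[OF k(3)] that unfolding b_def by fastforce
      then show ?thesis using ab by (simp add: h_def divide_nonpos_pos max_absorb1)
    qed
    have "measure m {x \<in> space m. \<forall>i<N. (T ^^ (q * i)) x \<notin> suplevel m \<phi> k}
      \<le> measure m {x \<in> space m. \<forall>i<N. h ((T ^^ (q * i)) x) = 0}"
      by (intro finite_measure_mono) (auto intro!: hA measurable_space[OF Tn])
    also have "\<dots> \<le> 1 / (real N * expectation h) + (K / b)\<^sup>2 * D / (expectation h)\<^sup>2"
      using p p0 h01 cov q N by (intro avoidance_probability[OF T h]) auto
    also have "\<dots> \<le> 1 / (real N * (c / 2 * ?m k)) + (K / b)\<^sup>2 * D / (c / 2 * ?m k)\<^sup>2"
      using p p0 p1 N D(2) c(1) mk by (intro add_mono divide_left_mono mult_left_mono power_mono mult_pos_pos zero_less_power) auto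
    also have "\<dots> = (2 / c) / (real N * ?m k) + (K\<^sup>2 * 4 / c\<^sup>2) * D * (1 / (b\<^sup>2 * (?m k)\<^sup>2))"
      using c by (simp add: field_simps power2_eq_square)
    also have "1 / (b\<^sup>2 * (?m k)\<^sup>2) = ?m k powr (- (2 * \<beta> + 2))"
    proof -
      have "b\<^sup>2 * (?m k)\<^sup>2 = ?m k powr (2 * \<beta> + 2)"
        using mk unfolding b_def mult_2 powr_add by (simp add: power2_eq_square)
      then show ?thesis by (simp only: powr_minus inverse_eq_divide)
    qed
    also have "(2 / c) / (real N * ?m k) + (K\<^sup>2 * 4 / c\<^sup>2) * D * (?m k powr (- (2 * \<beta> + 2)))
      \<le> C / (real N * ?m k) + C * D * ?m k powr (- (2 * \<beta> + 2))"
      using mk N D by (intro add_mono divide_right_mono mult_right_mono) (auto simp: C_def)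
    finally show ?thesis .
  qed
  have "\<forall>\<^sub>F k in sequentially. k \<ge> n1 \<and> k \<ge> n2 \<and> k \<ge> n3"
    by (intro eventually_conj eventually_ge_at_top)
  then have "\<forall>\<^sub>F k in sequentially. \<forall>q>0. \<forall>N>0. \<forall>D. (\<forall>l\<ge>q. \<Theta> l \<le> D) \<longrightarrow> 0 \<le> D \<longrightarrow>
    measure m {x \<in> space m. \<forall>i<N. (T ^^ (q * i)) x \<notin> suplevel m \<phi> k}
      \<le> C / (real N * ?m k) + C * D * ?m k powr (- (2 * \<beta> + 2))"
    by eventually_elim (use main in blast)
  then show ?thesis using C \<beta> by (intro exI[of _ C] conjI exI[of _ "2 * \<beta> + 2"]) auto
qed


lemma consecutive_powers:
  fixes n r :: nat
  assumes "0 < r"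
  shows "\<exists>q. q ^ r \<le> n \<and> n < Suc q ^ r"
proof -
  define p where "p = (LEAST j. n < j ^ r)"
  have "n < Suc n ^ r"
    using assms self_le_power[of "Suc n" r] by (simp add: less_eq_Suc_le)
  then have p: "n < p ^ r" unfolding p_def by (rule LeastI)
  then have "p \<noteq> 0" using assms by (cases p) (auto simp: power_0_left)
  then obtain q where q: "p = Suc q" by (cases p) auto
  then have "\<not> n < q ^ r" using not_less_Least[of q "\<lambda>j. n < j ^ r"] unfolding p_def[symmetric] by simp
  then show ?thesis using p q by (intro exI[of _ q]) auto
qed

lemma filterlim_Suc_powr_at_top:
  assumes "0 < c"
  shows "filterlim (\<lambda>n. real (Suc n) powr c) at_top sequentially"
proof -
  have "filterlim (\<lambda>n. real (Suc n)) at_top sequentially"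
    using filterlim_compose[OF filterlim_real_sequentially filterlim_Suc] by simp
  then have "filterlim (\<lambda>n. exp (c * ln (real (Suc n)))) at_top sequentially"
    using assms
    by (intro filterlim_compose[OF exp_at_top] filterlim_tendsto_pos_mult_at_top[OF tendsto_const]
        filterlim_compose[OF ln_at_top]) auto
  then show ?thesis by (simp add: powr_def)
qed

text \<open>
  A dynamical Borel-Cantelli argument along the sparse times \<open>q\<^sup>r\<close>. The level tested at time \<open>q\<^sup>r\<close> is
  already \<open>(q + 1)\<^sup>r\<^sup>s\<close>, so that a hit also serves every \<open>n\<close> between \<open>q\<^sup>r\<close> and \<open>(q + 1)\<^sup>r\<close>.
  With \<open>\<alpha> < a < 1/s\<close> the suplevel has measure at least of order \<open>q\<^sup>-\<^sup>t\<close> where \<open>t = r s a < r\<close>; there are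
  \<open>q\<^sup>r\<^sup>-\<^sup>1\<close> samples, and \<open>r\<close> is chosen so large that \<open>t - (r - 1) \<le> -2\<close>.
\<close>

lemma suplevels_hit_eventually:
  fixes m :: "'a::metric_space measure" and s \<alpha> :: real
  assumes "prob_space m"
    and T: "measure_preserving_map m T"
    and cont: "\<And>u :: 'a \<Rightarrow> real. continuous_on (space m) u \<Longrightarrow> u \<in> borel_measurable m"
    and decay: "SPDC m T"
    and reg: "asymptotically_regular m \<phi> \<alpha>" and \<alpha>: "0 \<le> \<alpha>"
    and s: "0 < s" "s * \<alpha> < 1"
  shows "AE x in m. \<forall>\<^sub>F n in sequentially. \<exists>j<n. real n powr s \<le> \<phi> ((T ^^ j) x)"
proof -
  interpret prob_space m by fact
  let ?m = "\<lambda>k. measure m (suplevel m \<phi> k)"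
  have A[measurable]: "suplevel m \<phi> n \<in> sets m" for n
    using reg unfolding asymptotically_regular_def by blast
  have Tn[measurable]: "(T ^^ n) \<in> m \<rightarrow>\<^sub>M m" for n
    using measure_preserving_funpow[OF T] by (simp add: measure_preserving_map_def)
  obtain \<Theta> :: "nat \<Rightarrow> real" where \<Theta>: "\<And>a. a > 0 \<Longrightarrow> (\<lambda>n. real n powr a * \<Theta> n) \<longlonglongrightarrow> 0"
    and dec: "\<And>g h n. bounded_lipschitz_on (space m) g \<Longrightarrow> bounded_lipschitz_on (space m) h \<Longrightarrow>
        \<bar>(\<integral>x. g ((T ^^ n) x) * h x \<partial>m) - (\<integral>x. g x \<partial>m) * (\<integral>x. h x \<partial>m)\<bar>
              \<le> lipschitz_norm (space m) g * lipschitz_norm (space m) h * \<Theta> n"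
    using decay unfolding SPDC_def by blast
  obtain C e where C: "C > 0" and e: "e > 0" and
    avoid: "\<forall>\<^sub>F k in sequentially. \<forall>q>0. \<forall>N>0. \<forall>D. (\<forall>l\<ge>q. \<Theta> l \<le> D) \<longrightarrow> 0 \<le> D \<longrightarrow>
      measure m {x \<in> space m. \<forall>i<N. (T ^^ (q * i)) x \<notin> suplevel m \<phi> k}
      \<le> C / (real N * ?m k) + C * D * ?m k powr (- e)"
    using suplevel_avoidance_probability[OF \<open>prob_space m\<close> T cont dec reg] by blast
  have "\<alpha> < 1 / s" using s by (simp add: field_simps)
  then obtain a where a: "\<alpha> < a" "a < 1 / s" using dense by blast
  then have sa: "0 < s * a" "s * a < 1" using s \<alpha> by (auto simp: field_simps)
  obtain r0 :: nat where "3 / (1 - s * a) < real r0" using reals_Archimedean2 by blast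
  have "0 < 3 / (1 - s * a)" using sa by simp
  then have "0 < real r0" using \<open>3 / (1 - s * a) < real r0\<close> by linarith
  then have r0: "0 < r0" by simp
  define r where "r = Suc r0"
  have r: "3 \<le> real r * (1 - s * a)"
    using \<open>3 / (1 - s * a) < real r0\<close> sa unfolding r_def by (simp add: field_simps)
  define t where "t = real r * s * a"
  have "t = real r * (s * a)" by (simp add: t_def)
  then have t: "0 < t" "t + 3 \<le> real r"
    using r sa mult_pos_pos[of "real r" "s * a"] by (auto simp: r_def right_diff_distrib)
  define k where "k = (\<lambda>q. nat \<lceil>real (Suc q) powr (real r * s)\<rceil>)"
  define B where "B = 2 * 2 powr (real r * s)"
  have B: "B > 0" by (simp add: B_def)
  have k_ge: "real (Suc q) powr (real r * s) \<le> real (k q)" for q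
    unfolding k_def by linarith
  have k_le: "real (k q) \<le> B * real q powr (real r * s)" if "q \<ge> 1" for q
  proof -
    have "1 \<le> real (Suc q) powr (real r * s)" using s by (intro ge_one_powr_ge_zero) auto
    then have "real (k q) \<le> 2 * real (Suc q) powr (real r * s)"
      unfolding k_def by linarith
    also have "\<dots> \<le> 2 * (2 * real q) powr (real r * s)"
      using that s by (intro mult_left_mono powr_mono2) auto
    also have "\<dots> = B * real q powr (real r * s)" by (simp add: B_def powr_mult)
    finally show ?thesis .
  qed
  have k_lim: "filterlim k at_top sequentially"
  proof -
    have "filterlim (\<lambda>q. real (Suc q) powr (real r * s)) at_top sequentially"
      using s by (intro filterlim_Suc_powr_at_top) (simp add: r_def)
    then have "filterlim (\<lambda>q. real (k q)) at_top sequentially"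
      by (rule filterlim_at_top_mono) (use k_ge in simp)
    then show ?thesis by (simp add: filterlim_sequentially_iff_filterlim_real)
  qed
  \<comment> \<open>The rate of decay that leaves \<open>q\<^sup>-\<^sup>2\<close> after paying \<open>q\<^sup>t\<^sup>e\<close> for the Lipschitz norms.\<close>
  define b where "b = t * e + 2"
  have b: "b > 0" using t e by (simp add: b_def add_pos_pos)
  have "\<forall>\<^sub>F l in sequentially. real l powr b * \<Theta> l < 1"
    using order_tendstoD(2)[OF \<Theta>[OF b]] by simp
  then obtain l0 where l0: "\<And>l. l \<ge> l0 \<Longrightarrow> real l powr b * \<Theta> l < 1"
    by (auto simp: eventually_sequentially)
  define F where "F = (\<lambda>q. {x \<in> space m. \<forall>i<q ^ r0. (T ^^ (q * i)) x \<notin> suplevel m \<phi> (k q)})"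
  have F[measurable]: "F q \<in> sets m" for q unfolding F_def by measurable
  define E where "E = C / B powr (- a) + C * (B powr (- a)) powr (- e)"
  have bound: "\<forall>\<^sub>F q in sequentially. norm (measure m (F q)) \<le> E * real q powr (- 2)"
  proof -
    have "\<forall>\<^sub>F q in sequentially. real (k q) powr (- a) < ?m (k q)"
      using k_lim[unfolded filterlim_iff, rule_format, OF asymptotically_regular_lower[OF reg a(1)]] .
    moreover have "\<forall>\<^sub>F q' in sequentially. \<forall>q>0. \<forall>N>0. \<forall>D. (\<forall>l\<ge>q. \<Theta> l \<le> D) \<longrightarrow> 0 \<le> D \<longrightarrow>
      measure m {x \<in> space m. \<forall>i<N. (T ^^ (q * i)) x \<notin> suplevel m \<phi> (k q')}
      \<le> C / (real N * ?m (k q')) + C * D * ?m (k q') powr (- e)"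
      using k_lim[unfolded filterlim_iff, rule_format, OF avoid] .
    ultimately show ?thesis using eventually_ge_at_top[of l0] eventually_ge_at_top[of 1]
    proof eventually_elim
      case (elim q)
      have q: "0 < real q" using elim by simp
      have "\<Theta> l \<le> real q powr (- b)" if "l \<ge> q" for l
      proof -
        have l: "0 < real l" using that q by linarith
        have "real l powr b * \<Theta> l < 1" using l0[of l] that elim by simp
        then have "\<Theta> l \<le> real l powr (- b)"
          using l by (simp add: powr_minus field_simps)
        also have "\<dots> \<le> real q powr (- b)"
          using that q b by (intro powr_mono2') auto
        finally show ?thesis .
      qed
      then have "measure m (F q) \<le> C / (real (q ^ r0) * ?m (k q)) + C * real q powr (- b) * ?m (k q) powr (- e)"
        using elim(2)[rule_format, of q "q ^ r0" "real q powr (- b)"] q unfolding F_def by simp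
      also have "\<dots> \<le> C / (real q ^ r0 * (B powr (- a) * real q powr (- t)))
        + C * real q powr (- b) * (B powr (- a) * real q powr (- t)) powr (- e)"
      proof -
        have "B powr (- a) * real q powr (- t) = (B * real q powr (real r * s)) powr (- a)"
          using B by (simp add: powr_mult powr_powr t_def)
        also have "\<dots> \<le> real (k q) powr (- a)"
        proof (rule powr_mono2')
          show "- a \<le> 0" using a(1) \<alpha> by simp
          have "0 < real (Suc q) powr (real r * s)" by simp
          then show "0 < real (k q)" using k_ge[of q] by linarith
          show "real (k q) \<le> B * real q powr (real r * s)" using k_le elim by simp
        qed
        finally have *: "B powr (- a) * real q powr (- t) \<le> ?m (k q)" using elim by linarith
        have **: "0 < B powr (- a) * real q powr (- t)" using q B by simp
        show ?thesis unfolding of_nat_power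
          using * ** C e q
          by (intro add_mono divide_left_mono mult_left_mono powr_mono2' mult_pos_pos) auto
      qed
      also have "\<dots> = C / B powr (- a) * real q powr (t - real r0)
         + C * (B powr (- a)) powr (- e) * real q powr (t * e - b)"
      proof -
        have "C / (real q ^ r0 * (X * real q powr (- t))) = C / X * real q powr (t - real r0)" for X
          using q by (simp add: powr_diff powr_minus powr_realpow field_simps)
        moreover have "C * real q powr (- b) * (X * real q powr (- t)) powr (- e)
            = C * X powr (- e) * real q powr (t * e - b)" if "0 < X" for X
          using q that by (simp add: powr_mult powr_powr powr_diff powr_minus[of _ b] divide_inverse)
        ultimately show ?thesis using B by simp
      qed
      also have "\<dots> \<le> C / B powr (- a) * real q powr (- 2)
         + C * (B powr (- a)) powr (- e) * real q powr (- 2)"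
        using C t elim
        by (intro add_mono mult_left_mono powr_mono) (auto simp: r_def b_def)
      also have "\<dots> = E * real q powr (- 2)" by (simp add: E_def algebra_simps)
      finally show ?case by simp
    qed
  qed
  have "summable (\<lambda>q. E * real q powr (- 2))"
    by (intro summable_mult) (simp add: summable_real_powr_iff)
  then have "summable (\<lambda>q. measure m (F q))"
    by (rule summable_comparison_test_ev[OF bound])
  then have "AE x in m. \<forall>\<^sub>F q in sequentially. x \<in> space m - F q"
    by (intro borel_cantelli_AE1) (auto simp: emeasure_eq_measure)
  then show ?thesis
  proof eventually_elim
    case (elim x)
    then obtain Q where Q: "\<And>q. q \<ge> Q \<Longrightarrow> x \<in> space m - F q"
      by (auto simp: eventually_sequentially)
    show ?case unfolding eventually_sequentially
    proof (rule exI[of _ "Q ^ r"], intro allI impI)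
      fix n assume n: "Q ^ r \<le> n"
      obtain q where q: "q ^ r \<le> n" "n < Suc q ^ r" using consecutive_powers[of r n] by (auto simp: r_def)
      have "Q < Suc q"
        using power_less_imp_less_base[of Q r "Suc q"] n q by simp
      then have "x \<in> space m - F q" using Q[of q] by simp
      then obtain i where i: "i < q ^ r0" "(T ^^ (q * i)) x \<in> suplevel m \<phi> (k q)"
        unfolding F_def by blast
      have "0 < q ^ r0" using i(1) by linarith
      then have "q * i < q ^ r" using i(1) r0 by (cases "q = 0") (auto simp: r_def)
      moreover have "real n powr s \<le> \<phi> ((T ^^ (q * i)) x)"
      proof -
        have "real n \<le> real (Suc q) ^ r" using q(2) by (metis less_imp_le of_nat_le_iff of_nat_power)
        then have "real n powr s \<le> (real (Suc q) ^ r) powr s"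
          using s by (intro powr_mono2) auto
        also have "\<dots> = real (Suc q) powr (real r * s)"
          by (simp add: powr_powr flip: powr_realpow)
        also have "\<dots> \<le> \<phi> ((T ^^ (q * i)) x)"
          using k_ge[of q] i(2) by (simp add: suplevel_def)
        finally show ?thesis .
      qed
      ultimately show "\<exists>j<n. real n powr s \<le> \<phi> ((T ^^ j) x)"
        using q(1) by (intro exI[of _ "q * i"]) simp
    qed
  qed
qed

section \<open>Upper bounds from invariance\<close>

lemma suplevels_avoided_eventually:
  fixes m :: "'a::metric_space measure" and s \<alpha> :: real
  assumes "prob_space m"
    and T: "measure_preserving_map m T"
    and reg: "asymptotically_regular m \<phi> \<alpha>"
    and s: "0 < s" "1 < s * \<alpha>"
  shows "AE x in m. \<forall>\<^sub>F j in sequentially. \<phi> ((T ^^ j) x) < real (Suc j) powr s"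
proof -
  interpret prob_space m by fact
  let ?m = "\<lambda>k. measure m (suplevel m \<phi> k)"
  have A[measurable]: "suplevel m \<phi> n \<in> sets m" for n
    using reg unfolding asymptotically_regular_def by blast
  have Tn[measurable]: "(T ^^ n) \<in> m \<rightarrow>\<^sub>M m" for n
    using measure_preserving_funpow[OF T] by (simp add: measure_preserving_map_def)
  have "1 / s < \<alpha>" using s by (simp add: field_simps)
  then obtain a where a: "1 / s < a" "a < \<alpha>" using dense by blast
  have a0: "0 < a" using a(1) s(1) by (meson less_trans zero_less_divide_1_iff)
  have sa: "1 < s * a" using a s by (simp add: field_simps)
  define k where "k = (\<lambda>j. nat \<lfloor>real (Suc j) powr s\<rfloor>)"
  have k1: "real (k j) \<le> real (Suc j) powr s" "real (Suc j) powr s / 2 \<le> real (k j)" for j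
  proof -
    have "1 \<le> real (Suc j) powr s" using s by (intro ge_one_powr_ge_zero) auto
    then show "real (k j) \<le> real (Suc j) powr s" "real (Suc j) powr s / 2 \<le> real (k j)"
      unfolding k_def using one_le_floor[of "real (Suc j) powr s"] by linarith+
  qed
  have k_lim: "filterlim k at_top sequentially"
  proof -
    have "filterlim (\<lambda>q. 1 / 2 * (real (Suc q) powr s)) at_top sequentially"
      using s(1) by (intro filterlim_tendsto_pos_mult_at_top[OF tendsto_const] filterlim_Suc_powr_at_top) auto
    then have "filterlim (\<lambda>q. real (Suc q) powr s / 2) at_top sequentially" by simp
    then have "filterlim (\<lambda>q. real (k q)) at_top sequentially"
      by (rule filterlim_at_top_mono) (use k1 in simp)
    then show ?thesis by (simp add: filterlim_sequentially_iff_filterlim_real)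
  qed
  define F where "F = (\<lambda>j. (T ^^ j) -` suplevel m \<phi> (k j) \<inter> space m)"
  have F[measurable]: "F j \<in> sets m" for j unfolding F_def by measurable
  have mF: "measure m (F j) = ?m (k j)" for j
    using measure_preserving_emeasure[OF measure_preserving_funpow[OF T] A]
    by (simp add: F_def measure_def)
  have "\<forall>\<^sub>F j in sequentially. ?m (k j) < real (k j) powr (- a)"
    using k_lim[unfolded filterlim_iff, rule_format, OF asymptotically_regular_upper[OF reg a(2)]] .
  then have bound: "\<forall>\<^sub>F j in sequentially. norm (measure m (F j)) \<le> 2 powr a * real (Suc j) powr (- (s * a))"
  proof eventually_elim
    case (elim j)
    have "real (k j) powr (- a) \<le> (real (Suc j) powr s / 2) powr (- a)"
      using k1[of j] a0 by (intro powr_mono2') auto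
    also have "\<dots> = 2 powr a * real (Suc j) powr (- (s * a))"
      by (simp add: powr_divide powr_powr powr_minus_divide)
    finally show ?case using elim by (simp add: mF)
  qed
  have "summable (\<lambda>j. 2 powr a * real (Suc j) powr (- (s * a)))"
    using sa summable_Suc_iff[of "\<lambda>j. real j powr (- (s * a))"]
    by (intro summable_mult) (simp add: summable_real_powr_iff)
  then have "summable (\<lambda>j. measure m (F j))"
    by (rule summable_comparison_test_ev[OF bound])
  then have "AE x in m. \<forall>\<^sub>F j in sequentially. x \<in> space m - F j"
    by (intro borel_cantelli_AE1) (auto simp: emeasure_eq_measure)
  then show ?thesis
  proof eventually_elim
    case (elim x)
    then show ?case
    proof eventually_elim
      case (elim j)
      then have "(T ^^ j) x \<in> space m" "(T ^^ j) x \<notin> suplevel m \<phi> (k j)"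
        using measurable_space[OF Tn] by (auto simp: F_def)
      then show ?case using k1(1)[of j] by (auto simp: suplevel_def)
    qed
  qed
qed


text \<open>
  Each term is at most \<open>x\<^sub>k\<^sup>p W\<^sup>1\<^sup>/\<^sup>p\<^sup>-\<^sup>1\<close>, where \<open>W\<close> is the sum of the \<open>p\<close>-th powers, because
  \<open>x\<^sub>k\<^sup>p \<le> W\<close>.
\<close>

lemma sum_le_powr_sum_powr:
  fixes x :: "'b \<Rightarrow> real"
  assumes "finite A" "\<And>k. k \<in> A \<Longrightarrow> 0 \<le> x k" "0 < p" "p \<le> 1"
  shows "(\<Sum>k\<in>A. x k) \<le> (\<Sum>k\<in>A. x k powr p) powr (1 / p)"
proof -
  define W where "W = (\<Sum>k\<in>A. x k powr p)"
  have W0: "0 \<le> W" unfolding W_def by (intro sum_nonneg) simp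
  have "x k \<le> x k powr p * W powr (1 / p - 1)" if k: "k \<in> A" for k
  proof (cases "x k = 0")
    case False
    then have xk: "0 < x k" using assms(2)[OF k] by simp
    have "x k powr p \<le> W" unfolding W_def using assms(1) k by (intro member_le_sum) auto
    then have "(x k powr p) powr (1 / p - 1) \<le> W powr (1 / p - 1)"
      using assms by (intro powr_mono2) auto
    then have "x k powr p * (x k powr p) powr (1 / p - 1) \<le> x k powr p * W powr (1 / p - 1)"
      by (intro mult_left_mono) auto
    moreover have "x k powr p * (x k powr p) powr (1 / p - 1) = x k"
    proof -
      have "p + p * (1 / p - 1) = 1" using assms(3) by (simp add: right_diff_distrib)
      then show ?thesis using xk by (simp add: powr_powr flip: powr_add)
    qed
    ultimately show ?thesis by simp
  qed simp
  then have "(\<Sum>k\<in>A. x k) \<le> (\<Sum>k\<in>A. x k powr p * W powr (1 / p - 1))"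
    by (intro sum_mono)
  also have "\<dots> = W * W powr (1 / p - 1)" by (simp add: W_def sum_distrib_right)
  also have "\<dots> = W powr (1 / p)" using W0 by (simp add: powr_mult_base)
  finally show ?thesis by (simp add: W_def)
qed

text \<open>
  For \<open>p \<le> 1\<close> the powers \<open>n\<^sup>p\<^sup>-\<^sup>1\<close> decrease, so \<open>R\<^sup>p = R R\<^sup>p\<^sup>-\<^sup>1\<close> is at most the sum of
  \<open>n\<^sup>p\<^sup>-\<^sup>1\<close> over \<open>1 \<le> n \<le> R\<close>. Integrating turns this into a series in the measures of the suplevels.
\<close>

lemma fractional_moment_finite:
  fixes R :: "'a::metric_space \<Rightarrow> nat"
  assumes "prob_space m"
    and reg: "asymptotically_regular m (\<lambda>x. real (R x)) \<alpha>"
    and p: "p < \<alpha>" "p \<le> 1"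
  shows "(\<integral>\<^sup>+x. ennreal (real (R x) powr p) \<partial>m) < \<infinity>"
proof -
  interpret prob_space m by fact
  let ?A = "suplevel m (\<lambda>x. real (R x))"
  have A[measurable]: "?A n \<in> sets m" for n
    using reg unfolding asymptotically_regular_def by blast
  obtain a where a: "p < a" "a < \<alpha>" using dense p(1) by blast
  have pointwise: "ennreal (real (R x) powr p)
      \<le> (\<Sum>n. ennreal (real (Suc n) powr (p - 1)) * indicator (?A (Suc n)) x)"
    if x: "x \<in> space m" for x
  proof -
    have "real (R x) powr p \<le> (\<Sum>n<R x. real (Suc n) powr (p - 1))"
    proof (cases "R x = 0")
      case False
      have "real (R x) powr p = (\<Sum>n<R x. real (R x) powr (p - 1))"
        using False by (simp add: powr_mult_base)
      also have "\<dots> \<le> (\<Sum>n<R x. real (Suc n) powr (p - 1))"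
        using p by (intro sum_mono powr_mono2') auto
      finally show ?thesis .
    qed simp
    then have "ennreal (real (R x) powr p) \<le> (\<Sum>n<R x. ennreal (real (Suc n) powr (p - 1)))"
      by (simp add: sum_ennreal ennreal_leI)
    also have "\<dots> = (\<Sum>n<R x. ennreal (real (Suc n) powr (p - 1)) * indicator (?A (Suc n)) x)"
      using x by (intro sum.cong) (auto simp: suplevel_def)
    also have "\<dots> \<le> (\<Sum>n. ennreal (real (Suc n) powr (p - 1)) * indicator (?A (Suc n)) x)"
      by (intro sum_le_suminf) auto
    finally show ?thesis .
  qed
  have "\<forall>\<^sub>F n in sequentially. measure m (?A (Suc n)) < real (Suc n) powr (- a)"
    using asymptotically_regular_upper[OF reg a(2)] by (subst eventually_sequentially_Suc)
  then have bound: "\<forall>\<^sub>F n in sequentially. norm (real (Suc n) powr (p - 1) * measure m (?A (Suc n)))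
      \<le> real (Suc n) powr (p - 1 - a)"
  proof eventually_elim
    case (elim n)
    then have "real (Suc n) powr (p - 1) * measure m (?A (Suc n)) \<le> real (Suc n) powr (p - 1) * real (Suc n) powr (- a)"
      by (intro mult_left_mono) auto
    also have "\<dots> = real (Suc n) powr (p - 1 - a)" by (simp flip: powr_add)
    finally show ?case by simp
  qed
  have "summable (\<lambda>n. real (Suc n) powr (p - 1 - a))"
    using a summable_Suc_iff[of "\<lambda>j. real j powr (p - 1 - a)"] by (simp add: summable_real_powr_iff)
  then have summ: "summable (\<lambda>n. real (Suc n) powr (p - 1) * measure m (?A (Suc n)))"
    by (rule summable_comparison_test_ev[OF bound])
  have "(\<integral>\<^sup>+x. ennreal (real (R x) powr p) \<partial>m)
      \<le> (\<integral>\<^sup>+x. (\<Sum>n. ennreal (real (Suc n) powr (p - 1)) * indicator (?A (Suc n)) x) \<partial>m)"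
    by (intro nn_integral_mono pointwise)
  also have "\<dots> = (\<Sum>n. \<integral>\<^sup>+x. ennreal (real (Suc n) powr (p - 1)) * indicator (?A (Suc n)) x \<partial>m)"
    by (intro nn_integral_suminf) measurable
  also have "\<dots> = (\<Sum>n. ennreal (real (Suc n) powr (p - 1) * measure m (?A (Suc n))))"
    by (intro suminf_cong) (simp add: nn_integral_cmult emeasure_eq_measure ennreal_mult)
  also have "\<dots> < \<infinity>"
    using summ by (subst suminf_ennreal2) auto
  finally show ?thesis .
qed

text \<open>
  With \<open>1/u < p < \<alpha>\<close>, the series of \<open>R(T\<^sup>k x)\<^sup>p (k + 1)\<^sup>-\<^sup>p\<^sup>u\<close> has finite integral and so converges almost
  everywhere, to \<open>V\<close> say. Then the first \<open>n\<close> of the \<open>R(T\<^sup>k x)\<^sup>p\<close> add up to at most \<open>V n\<^sup>p\<^sup>u\<close>, and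
  taking \<open>p\<close>-th roots bounds the sum of the \<open>R(T\<^sup>k x)\<close>.
\<close>

lemma Birkhoff_sum_growth:
  fixes R :: "'a::metric_space \<Rightarrow> nat"
  assumes "prob_space m"
    and T: "measure_preserving_map m T"
    and R[measurable]: "R \<in> m \<rightarrow>\<^sub>M count_space UNIV"
    and reg: "asymptotically_regular m (\<lambda>x. real (R x)) \<alpha>"
    and \<alpha>: "\<alpha> \<le> 1" and u: "0 < u" "1 < u * \<alpha>"
  shows "AE x in m. \<exists>C>0. \<forall>n. real (\<Sum>k<n. R ((T ^^ k) x)) \<le> C * real n powr u"
proof -
  interpret prob_space m by fact
  have Tn[measurable]: "(T ^^ n) \<in> m \<rightarrow>\<^sub>M m" for n
    using measure_preserving_funpow[OF T] by (simp add: measure_preserving_map_def)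
  have "1 / u < \<alpha>" using u by (simp add: field_simps)
  then obtain p where p: "1 / u < p" "p < \<alpha>" using dense by blast
  have p0: "0 < p" using p(1) u(1) by (meson less_trans zero_less_divide_1_iff)
  have p1: "p \<le> 1" using p \<alpha> by simp
  have pu: "1 < p * u" using p u by (simp add: field_simps)
  define w where "w = (\<lambda>k x. real (R ((T ^^ k) x)) powr p * real (Suc k) powr (- (p * u)))"
  have w0: "0 \<le> w k x" for k x by (simp add: w_def)
  have [measurable]: "w k \<in> borel_measurable m" for k unfolding w_def by measurable
  define I where "I = (\<integral>\<^sup>+x. ennreal (real (R x) powr p) \<partial>m)"
  have I: "I < \<infinity>" unfolding I_def by (rule fractional_moment_finite[OF \<open>prob_space m\<close> reg p(2) p1])
  have "(\<integral>\<^sup>+x. ennreal (w k x) \<partial>m) = I * ennreal (real (Suc k) powr (- (p * u)))" for k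
  proof -
    have "(\<integral>\<^sup>+x. ennreal (w k x) \<partial>m) = (\<integral>\<^sup>+x. ennreal (real (R ((T ^^ k) x)) powr p) \<partial>m) * ennreal (real (Suc k) powr (- (p * u)))"
      unfolding w_def by (simp add: ennreal_mult nn_integral_multc)
    then show ?thesis
      using measure_preserving_nn_integral[OF measure_preserving_funpow[OF T], of "\<lambda>x. ennreal (real (R x) powr p)" k]
      by (simp add: I_def)
  qed
  then have "(\<integral>\<^sup>+x. (\<Sum>k. ennreal (w k x)) \<partial>m) = I * (\<Sum>k. ennreal (real (Suc k) powr (- (p * u))))"
    by (simp add: nn_integral_suminf)
  also have "\<dots> < \<infinity>"
  proof -
    have "summable (\<lambda>k. real (Suc k) powr (- (p * u)))"
      using pu summable_Suc_iff[of "\<lambda>j. real j powr (- (p * u))"] by (simp add: summable_real_powr_iff)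
    then have "(\<Sum>k. ennreal (real (Suc k) powr (- (p * u)))) < \<infinity>"
      by (subst suminf_ennreal2) auto
    then show ?thesis using I by (simp add: ennreal_mult_less_top)
  qed
  finally have "AE x in m. (\<Sum>k. ennreal (w k x)) \<noteq> \<infinity>"
    by (intro nn_integral_PInf_AE) auto
  then show ?thesis
  proof eventually_elim
    case (elim x)
    then have summ: "summable (\<lambda>k. w k x)"
      using summable_suminf_not_top[of "\<lambda>k. w k x"] w0 by auto
    define V where "V = (\<Sum>k. w k x)"
    have V0: "0 \<le> V" unfolding V_def using summ w0 by (intro suminf_nonneg)
    have "real (\<Sum>k<n. R ((T ^^ k) x)) \<le> (V powr (1 / p) + 1) * real n powr u" for n
    proof -
      have "(\<Sum>k<n. real (R ((T ^^ k) x)) powr p) \<le> (\<Sum>k<n. w k x * real n powr (p * u))"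
      proof (rule sum_mono)
        fix k assume "k \<in> {..<n}"
        then have "real (Suc k) powr (p * u) \<le> real n powr (p * u)"
          using pu by (intro powr_mono2) auto
        then have "w k x * real (Suc k) powr (p * u) \<le> w k x * real n powr (p * u)"
          using w0 by (intro mult_left_mono)
        moreover have "w k x * real (Suc k) powr (p * u) = real (R ((T ^^ k) x)) powr p"
          by (simp add: w_def flip: powr_add mult.assoc)
        ultimately show "real (R ((T ^^ k) x)) powr p \<le> w k x * real n powr (p * u)" by simp
      qed
      also have "\<dots> = (\<Sum>k<n. w k x) * real n powr (p * u)" by (simp add: sum_distrib_right)
      also have "\<dots> \<le> V * real n powr (p * u)"
        unfolding V_def using summ w0 by (intro mult_right_mono sum_le_suminf) auto
      finally have W: "(\<Sum>k<n. real (R ((T ^^ k) x)) powr p) \<le> V * real n powr (p * u)" .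
      have "real (\<Sum>k<n. R ((T ^^ k) x)) \<le> (\<Sum>k<n. real (R ((T ^^ k) x)) powr p) powr (1 / p)"
        using sum_le_powr_sum_powr[of "{..<n}" "\<lambda>k. real (R ((T ^^ k) x))" p] p0 p1 by simp
      also have "\<dots> \<le> (V * real n powr (p * u)) powr (1 / p)"
        using W p0 by (intro powr_mono2) (auto intro!: sum_nonneg)
      also have "\<dots> = V powr (1 / p) * real n powr u"
        using V0 p0 by (simp add: powr_mult powr_powr)
      also have "\<dots> \<le> (V powr (1 / p) + 1) * real n powr u"
        by (intro mult_right_mono) auto
      finally show ?thesis .
    qed
    then show ?case by (intro exI[of _ "V powr (1 / p) + 1"]) (auto intro: add_nonneg_pos)
  qed
qed


section \<open>The return map of a recurrent domain\<close>

locale recurrent_domain =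
  fixes M :: "'a measure" and f :: "'a \<Rightarrow> 'a" and Y :: "'a set"
  assumes space_M: "space M = UNIV"
    and preserving: "measure_preserving_map M f"
    and conservative: "conservative M f"
    and Y_sets[measurable]: "Y \<in> sets M"
    and Y_pos: "0 < emeasure M Y"
    and Y_finite: "emeasure M Y < \<infinity>"
begin

abbreviation "R \<equiv> return_time f Y"
abbreviation "\<nu> \<equiv> induced_measure M Y"

text \<open>
  A point of \<open>Y\<close> that never returns has no meaningful return time, and \<open>induced_map\<close> need not keep
  it in \<open>Y\<close>. Fixing these points makes the return map a self-map of all of \<open>Y\<close>; it differs from
  \<open>induced_map\<close> there on a null set only.
\<close>

definition return_map :: "'a \<Rightarrow> 'a" where
  "return_map x = (if \<exists>n>0. (f ^^ n) x \<in> Y then induced_map f Y x else x)"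

abbreviation "T \<equiv> return_map"

definition first_entry :: "'a set \<Rightarrow> nat \<Rightarrow> 'a set" where
  "first_entry B n = {x. (f ^^ n) x \<in> B \<and> (\<forall>i<n. (f ^^ i) x \<notin> Y)}"

text \<open>
  The indices are shifted: a point of \<open>first_return B n\<close> returns at time \<open>n + 1\<close>, and a point of
  \<open>not_returned n\<close> has not returned at any of the times \<open>1, ..., n\<close>.
\<close>

definition first_return :: "'a set \<Rightarrow> nat \<Rightarrow> 'a set" where
  "first_return B n = {x \<in> Y. (f ^^ Suc n) x \<in> B \<and> (\<forall>i<n. (f ^^ Suc i) x \<notin> Y)}"

definition not_returned :: "nat \<Rightarrow> 'a set" where
  "not_returned n = {x \<in> Y. \<forall>i<n. (f ^^ Suc i) x \<notin> Y}"

lemma funpow_measurable[measurable]: "(f ^^ n) \<in> M \<rightarrow>\<^sub>M M"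
  using measure_preserving_funpow[OF preserving] by (simp add: measure_preserving_map_def)

lemma sets_Collect_funpow[measurable (raw)]:
  "B \<in> sets M \<Longrightarrow> Measurable.pred M (\<lambda>x. (f ^^ n) x \<in> B)"
  using measurable_sets[OF funpow_measurable, of B n]
  by (simp add: pred_def vimage_def Int_def conj_commute)

lemma sets_Collect_UNIV: "Measurable.pred M P \<Longrightarrow> {x. P x} \<in> sets M"
  using space_M by (simp add: pred_def)

lemma avoids_measurable[measurable (raw)]:
  "Measurable.pred M (\<lambda>x. \<forall>i<n. (f ^^ i) x \<notin> Y)"
  "Measurable.pred M (\<lambda>x. \<forall>i<n. (f ^^ Suc i) x \<notin> Y)"
  by (intro pred_intros_countable(1) pred_intros_imp' pred_intros_logic sets_Collect_funpow Y_sets)+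

lemma first_entry_sets[measurable]: "B \<in> sets M \<Longrightarrow> first_entry B n \<in> sets M"
  unfolding first_entry_def
  by (intro sets_Collect_UNIV pred_intros_logic sets_Collect_funpow avoids_measurable
      pred_sets2[OF Y_sets] measurable_ident_sets[OF refl])

lemma first_return_sets[measurable]: "B \<in> sets M \<Longrightarrow> first_return B n \<in> sets M"
  unfolding first_return_def
  by (intro sets_Collect_UNIV pred_intros_logic sets_Collect_funpow avoids_measurable
      pred_sets2[OF Y_sets] measurable_ident_sets[OF refl])

lemma not_returned_sets[measurable]: "not_returned n \<in> sets M"
  unfolding not_returned_def by (rule sets_Collect_UNIV) measurable

lemma return_time_first_return:
  assumes "x \<in> first_return Y n"
  shows "R x = Suc n"
  unfolding return_time_def
proof (rule cInf_eq_minimum)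
  show "Suc n \<in> {n. 0 < n \<and> (f ^^ n) x \<in> Y}" using assms by (simp add: first_return_def)
  fix k assume "k \<in> {n. 0 < n \<and> (f ^^ n) x \<in> Y}"
  then obtain i where "k = Suc i" "(f ^^ Suc i) x \<in> Y" by (cases k) auto
  then show "Suc n \<le> k" using assms by (force simp: first_return_def not_less)
qed

lemma first_return_exists:
  assumes "x \<in> Y" "0 < k" "(f ^^ k) x \<in> Y"
  shows "\<exists>n<k. x \<in> first_return Y n"
proof -
  define n where "n = (LEAST n. (f ^^ Suc n) x \<in> Y)"
  have ex: "(f ^^ Suc (k - 1)) x \<in> Y" using assms by simp
  have "(f ^^ Suc n) x \<in> Y" unfolding n_def by (rule LeastI[of "\<lambda>n. (f ^^ Suc n) x \<in> Y", OF ex])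
  moreover have "n \<le> k - 1" unfolding n_def by (rule Least_le[of "\<lambda>n. (f ^^ Suc n) x \<in> Y", OF ex])
  moreover have "(f ^^ Suc i) x \<notin> Y" if "i < n" for i
    using not_less_Least[of i "\<lambda>n. (f ^^ Suc n) x \<in> Y"] that unfolding n_def by blast
  ultimately show ?thesis using assms by (intro exI[of _ n]) (auto simp: first_return_def)
qed

lemma return_time_measurable[measurable]: "R \<in> M \<rightarrow>\<^sub>M count_space UNIV"
proof -
  have "R = (\<lambda>x. LEAST n. 0 < n \<and> (f ^^ n) x \<in> Y)"
    by (auto simp: return_time_def Inf_nat_def fun_eq_iff)
  also have "\<dots> \<in> M \<rightarrow>\<^sub>M count_space UNIV" by measurable
  finally show ?thesis .
qed

lemma induced_map_measurable[measurable]: "induced_map f Y \<in> M \<rightarrow>\<^sub>M M"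
proof -
  have "(\<lambda>x. (f ^^ R x) x) \<in> M \<rightarrow>\<^sub>M M"
    by (rule measurable_compose_countable[where f = "\<lambda>n. f ^^ n"]) auto
  then show ?thesis by (simp add: induced_map_def[abs_def])
qed

lemma return_map_measurable[measurable]: "T \<in> M \<rightarrow>\<^sub>M M"
  unfolding return_map_def[abs_def] by measurable

lemma return_map_first_return: "x \<in> first_return Y n \<Longrightarrow> T x = (f ^^ Suc n) x"
  using return_time_first_return[of x n]
  by (auto simp: return_map_def induced_map_def first_return_def simp del: funpow.simps)

lemma return_map_mem:
  assumes "x \<in> Y"
  shows "T x \<in> Y"
proof (cases "\<exists>k>0. (f ^^ k) x \<in> Y")
  case True
  with assms obtain n where n: "x \<in> first_return Y n" using first_return_exists by blast
  then show ?thesis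
    using return_map_first_return[OF n] by (simp add: first_return_def del: funpow.simps)
next
  case False
  then have "T x = x" unfolding return_map_def by (rule if_not_P)
  then show ?thesis using assms by simp
qed

text \<open>
  This is a wandering set: an orbit that visits it twice would return to \<open>Y\<close>.
\<close>

lemma never_returning_null: "(\<Inter>n. not_returned n) \<in> null_sets M"
proof -
  let ?N = "\<Inter>n. not_returned n"
  have N: "?N \<in> sets M" by measurable
  have notin: "(f ^^ i) x \<notin> Y" if "x \<in> ?N" "0 < i" for x i
    using that by (cases i) (auto simp: not_returned_def)
  have sub: "?N \<subseteq> Y" by (auto simp: not_returned_def)
  have "disjoint_family (\<lambda>n. (f ^^ n) -` ?N \<inter> space M)"
  proof -
    have False if "m < n" "(f ^^ m) x \<in> ?N" "(f ^^ n) x \<in> ?N" for m n x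
    proof -
      have "(f ^^ n) x = (f ^^ (n - m)) ((f ^^ m) x)"
        using that by (simp add: funpow_add[symmetric, THEN fun_cong, unfolded comp_def])
      then show False using notin[OF that(2), of "n - m"] that(1,3) sub by auto
    qed
    then show ?thesis
      unfolding disjoint_family_on_def by (auto simp del: INT_iff) (metis linorder_neqE_nat)
  qed
  then have "emeasure M ?N = 0" using conservative N unfolding conservative_def by blast
  then show ?thesis using N by blast
qed

lemma AE_recurrent: "AE x in M. x \<in> Y \<longrightarrow> (\<forall>n. \<exists>k\<ge>n. (f ^^ k) x \<in> Y)"
proof -
  let ?N = "\<Inter>n. not_returned n"
  have "AE x in M. x \<notin> ?N" using never_returning_null by (rule AE_not_in)
  then have "AE x in M. \<forall>k. (f ^^ k) x \<notin> ?N"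
    unfolding AE_all_countable
    using measure_preserving_AE[OF measure_preserving_funpow[OF preserving], of "\<lambda>x. x \<notin> ?N"] by blast
  then show ?thesis
  proof eventually_elim
    case (elim x)
    show ?case
    proof (intro impI allI)
      fix n assume "x \<in> Y"
      show "\<exists>k\<ge>n. (f ^^ k) x \<in> Y"
      proof (induction n)
        case 0
        show ?case using \<open>x \<in> Y\<close> by (intro exI[of _ 0]) simp
      next
        case (Suc n)
        then obtain k where k: "k \<ge> n" "(f ^^ k) x \<in> Y" by blast
        then obtain i where "(f ^^ Suc i) ((f ^^ k) x) \<in> Y"
          using elim by (auto simp: not_returned_def simp del: funpow.simps)
        then have "(f ^^ (Suc i + k)) x \<in> Y" by (simp only: funpow_add comp_apply)
        then show ?case using k by (intro exI[of _ "Suc i + k"]) auto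
      qed
    qed
  qed
qed

text \<open>
  The preimage under \<open>f\<close> of the points that enter \<open>Y\<close> through \<open>B\<close> at time \<open>n\<close> splits according to
  whether the preimage point lies in \<open>Y\<close> or not. This one step of invariance yields both Kac's formula and
  the invariance of the return map.
\<close>

lemma emeasure_first_entry:
  assumes B[measurable]: "B \<in> sets M"
  shows "emeasure M (first_entry B n) = emeasure M (first_return B n) + emeasure M (first_entry B (Suc n))"
proof -
  have "emeasure M (first_entry B n) = emeasure M (f -` first_entry B n \<inter> space M)"
    using measure_preserving_emeasure[OF preserving, of "first_entry B n"] by simp
  also have "f -` first_entry B n \<inter> space M = first_return B n \<union> first_entry B (Suc n)"
  proof -
    have "(f ^^ k) (f x) = (f ^^ Suc k) x" for k x by (simp add: funpow_swap1)
    moreover have "(\<forall>i<Suc n. (f ^^ i) x \<notin> Y) \<longleftrightarrow> x \<notin> Y \<and> (\<forall>i<n. (f ^^ Suc i) x \<notin> Y)" for x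
      by (subst All_less_Suc2) simp
    ultimately show ?thesis
      unfolding first_entry_def first_return_def using space_M
      by (auto simp del: funpow.simps)
  qed
  also have "emeasure M \<dots> = emeasure M (first_return B n) + emeasure M (first_entry B (Suc n))"
    by (intro plus_emeasure[symmetric] first_return_sets first_entry_sets B)
      (auto simp: first_return_def first_entry_def)
  finally show ?thesis .
qed

lemma emeasure_subset_finite: "A \<subseteq> Y \<Longrightarrow> emeasure M A \<noteq> \<infinity>"
  using emeasure_mono[of A Y M] Y_finite by (auto simp: top_unique)

lemma emeasure_first_entry_Y: "emeasure M (first_entry Y n) = emeasure M (not_returned n)"
proof (induction n)
  case 0
  show ?case by (simp add: first_entry_def not_returned_def)
next
  case (Suc n)
  have "not_returned n = first_return Y n \<union> not_returned (Suc n)"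
    by (auto simp: not_returned_def first_return_def less_Suc_eq simp del: funpow.simps)
  moreover have "emeasure M (first_return Y n \<union> not_returned (Suc n))
     = emeasure M (first_return Y n) + emeasure M (not_returned (Suc n))"
    by (intro plus_emeasure[symmetric] first_return_sets not_returned_sets Y_sets)
      (auto simp: first_return_def not_returned_def less_Suc_eq simp del: funpow.simps)
  ultimately have "emeasure M (not_returned n)
     = emeasure M (first_return Y n) + emeasure M (not_returned (Suc n))" by metis
  then have "emeasure M (first_return Y n) + emeasure M (first_entry Y (Suc n))
     = emeasure M (first_return Y n) + emeasure M (not_returned (Suc n))"
    using emeasure_first_entry[OF Y_sets, of n] Suc by metis
  moreover have "emeasure M (first_return Y n) \<noteq> \<infinity>"
    by (rule emeasure_subset_finite) (auto simp: first_return_def)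
  ultimately show ?case by (simp add: ennreal_add_left_cancel)
qed

lemma not_returned_tendsto_0: "(\<lambda>n. emeasure M (not_returned n)) \<longlonglongrightarrow> 0"
proof -
  have "(\<lambda>n. emeasure M (not_returned n)) \<longlonglongrightarrow> emeasure M (\<Inter>n. not_returned n)"
  proof (rule Lim_emeasure_decseq)
    show "range not_returned \<subseteq> sets M" by auto
    show "decseq not_returned" by (auto simp: decseq_def not_returned_def)
    show "emeasure M (not_returned i) \<noteq> \<infinity>" for i
      using emeasure_subset_finite[of "not_returned i"] by (auto simp: not_returned_def)
  qed
  then show ?thesis using never_returning_null by auto
qed

text \<open>
  Iterating the previous splitting writes the measure of \<open>B\<close> as that of the points returning through
  \<open>B\<close> within \<open>n\<close> steps plus a remainder. The remainder is at most the measure of \<open>not_returned n\<close>, which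
  tends to 0.
\<close>

lemma emeasure_return_map_vimage:
  assumes B[measurable]: "B \<in> sets M" and "B \<subseteq> Y"
  shows "emeasure M (T -` B \<inter> Y) = emeasure M B"
proof -
  have "emeasure M B = (\<Sum>k<n. emeasure M (first_return B k)) + emeasure M (first_entry B n)" for n
  proof (induction n)
    case 0
    show ?case by (simp add: first_entry_def)
  next
    case (Suc n)
    then show ?case by (simp add: emeasure_first_entry[OF B, of n] add.assoc)
  qed
  moreover have "(\<lambda>n. emeasure M (first_entry B n)) \<longlonglongrightarrow> 0"
  proof (rule tendsto_sandwich[OF _ _ tendsto_const not_returned_tendsto_0])
    show "\<forall>\<^sub>F n in sequentially. emeasure M (first_entry B n) \<le> emeasure M (not_returned n)"
      unfolding emeasure_first_entry_Y[symmetric]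
      using \<open>B \<subseteq> Y\<close>
      by (intro always_eventually allI emeasure_mono first_entry_sets Y_sets) (auto simp: first_entry_def)
  qed simp
  then have "(\<lambda>n. (\<Sum>k<n. emeasure M (first_return B k)) + emeasure M (first_entry B n))
     \<longlonglongrightarrow> (\<Sum>k. emeasure M (first_return B k)) + 0"
    by (intro tendsto_add summable_LIMSEQ summableI)
  ultimately have "emeasure M B = (\<Sum>k. emeasure M (first_return B k))"
    using LIMSEQ_unique[OF tendsto_const] by simp
  also have "\<dots> = emeasure M (\<Union>k. first_return B k)"
  proof (rule suminf_emeasure)
    have "x \<in> first_return Y k" if "x \<in> first_return B k" for x k
      using that \<open>B \<subseteq> Y\<close> by (auto simp: first_return_def simp del: funpow.simps)
    then have "i = j" if "x \<in> first_return B i" "x \<in> first_return B j" for x i j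
      using return_time_first_return that by (metis nat.inject)
    then show "disjoint_family (first_return B)" by (auto simp: disjoint_family_on_def)
  qed auto
  also have "\<dots> = emeasure M (T -` B \<inter> Y)"
  proof (rule emeasure_eq_AE)
    have "AE x in M. x \<notin> (\<Inter>n. not_returned n)" using never_returning_null by (rule AE_not_in)
    then show "AE x in M. (x \<in> (\<Union>k. first_return B k)) = (x \<in> T -` B \<inter> Y)"
    proof eventually_elim
      case (elim x)
      show ?case
      proof
        assume "x \<in> (\<Union>k. first_return B k)"
        then obtain k where "x \<in> first_return B k" by blast
        then have "x \<in> first_return Y k" "(f ^^ Suc k) x \<in> B"
          using \<open>B \<subseteq> Y\<close> by (auto simp: first_return_def simp del: funpow.simps)
        then show "x \<in> T -` B \<inter> Y"
          using return_map_first_return by (auto simp: first_return_def simp del: funpow.simps)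
      next
        assume x: "x \<in> T -` B \<inter> Y"
        then obtain i where "(f ^^ Suc i) x \<in> Y"
          using elim by (auto simp: not_returned_def simp del: funpow.simps)
        then obtain k where k: "x \<in> first_return Y k" using first_return_exists[of x "Suc i"] x by blast
        then have "x \<in> first_return B k"
          using return_map_first_return[OF k] x by (auto simp: first_return_def simp del: funpow.simps)
        then show "x \<in> (\<Union>k. first_return B k)" by blast
      qed
    qed
    show "(\<Union>k. first_return B k) \<in> sets M" by measurable
    have "T -` B \<inter> space M \<inter> Y \<in> sets M" by measurable
    then show "T -` B \<inter> Y \<in> sets M" by (simp add: space_M)
  qed
  finally show ?thesis by simp
qed

lemma space_induced: "space \<nu> = Y"
  by (simp add: induced_measure_def space_restrict_space space_M)

lemma sets_induced: "sets \<nu> = sets (restrict_space M Y)"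
  by (auto simp: induced_measure_def sets_restrict_space)

lemma sets_induced_iff: "A \<in> sets \<nu> \<longleftrightarrow> A \<in> sets M \<and> A \<subseteq> Y"
  unfolding sets_induced by (subst sets_restrict_space_iff) (auto simp: space_M)

lemma emeasure_induced:
  assumes "A \<in> sets \<nu>"
  shows "emeasure \<nu> A = emeasure M A / emeasure M Y"
proof -
  have A: "A \<in> sets M" "A \<subseteq> Y" using assms by (auto simp: sets_induced_iff)
  have "emeasure \<nu> A = emeasure (uniform_measure M Y) A"
    unfolding induced_measure_def using A by (intro emeasure_restrict_space) (auto simp: space_M)
  then show ?thesis using A by (simp add: Int_absorb1)
qed

lemma AE_induced_iff: "(AE x in \<nu>. P x) \<longleftrightarrow> (AE x in M. x \<in> Y \<longrightarrow> P x)"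
  unfolding induced_measure_def
  using Y_pos Y_finite by (subst AE_restrict_space_iff) (auto simp: space_M AE_uniform_measure)

lemma prob_space_induced: "prob_space \<nu>"
proof
  have "Y \<in> sets \<nu>" by (simp add: sets_induced_iff)
  then show "emeasure \<nu> (space \<nu>) = 1"
    unfolding space_induced using emeasure_induced[of Y] Y_pos Y_finite by (simp add: ennreal_divide_self)
qed

lemma measurable_induced: "g \<in> M \<rightarrow>\<^sub>M N \<Longrightarrow> g \<in> \<nu> \<rightarrow>\<^sub>M N"
  using measurable_restrict_space1[of g M N Y] measurable_cong_sets[OF sets_induced refl] by blast

lemma return_map_preserving: "measure_preserving_map \<nu> T"
  unfolding measure_preserving_map_def
proof
  show T: "T \<in> \<nu> \<rightarrow>\<^sub>M \<nu>"
  proof (rule measurableI)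
    show "T x \<in> space \<nu>" if "x \<in> space \<nu>" for x using that return_map_mem by (simp add: space_induced)
    fix A assume "A \<in> sets \<nu>"
    then have "A \<in> sets M" by (simp add: sets_induced_iff)
    then show "T -` A \<inter> space \<nu> \<in> sets \<nu>"
      using measurable_sets[OF measurable_induced[OF return_map_measurable]] by blast
  qed
  show "distr \<nu> \<nu> T = \<nu>"
  proof (rule measure_eqI)
    fix A assume "A \<in> sets (distr \<nu> \<nu> T)"
    then have A: "A \<in> sets \<nu>" by simp
    then have "T -` A \<inter> Y \<in> sets \<nu>" using measurable_sets[OF T A] by (simp add: space_induced)
    then show "emeasure (distr \<nu> \<nu> T) A = emeasure \<nu> A"
      using A T emeasure_return_map_vimage[of A]
      by (simp add: emeasure_distr space_induced emeasure_induced) (simp add: sets_induced_iff)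
  qed simp
qed

text \<open>
  The set of these points is exactly invariant, and by recurrence it contains almost all of \<open>Y\<close>.
\<close>

lemma AE_visits_infinitely_often:
  assumes erg: "ergodic M f"
  shows "AE x in M. \<forall>n. \<exists>k\<ge>n. (f ^^ k) x \<in> Y"
proof -
  let ?E = "{x. \<forall>n. \<exists>k\<ge>n. (f ^^ k) x \<in> Y}"
  have E[measurable]: "?E \<in> sets M" by (rule sets_Collect_UNIV) measurable
  have "f -` ?E \<inter> space M = ?E"
  proof -
    have "(\<forall>n. \<exists>k\<ge>n. (f ^^ k) (f x) \<in> Y) \<longleftrightarrow> (\<forall>n. \<exists>k\<ge>n. (f ^^ k) x \<in> Y)" for x
    proof -
      have *: "(f ^^ k) (f x) = (f ^^ Suc k) x" for k by (simp add: funpow_swap1)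
      show ?thesis unfolding *
        by (metis Suc_le_D Suc_le_mono le_SucI)
    qed
    then show ?thesis using space_M by auto
  qed
  then consider "?E \<in> null_sets M" | "space M - ?E \<in> null_sets M"
    using erg E unfolding ergodic_def by blast
  then show ?thesis
  proof cases
    case 1
    have "AE x in M. x \<notin> Y" using AE_recurrent AE_not_in[OF 1] by eventually_elim auto
    then have "emeasure M Y = 0" using AE_iff_measurable[OF Y_sets, of "\<lambda>x. x \<notin> Y"] space_M by auto
    then show ?thesis using Y_pos by simp
  next
    case 2
    then show ?thesis by (rule AE_I') (auto simp: space_M)
  qed
qed

text \<open>
  The half of Kac's formula that bounds the total mass by the integral of the return time over \<open>Y\<close>,
  written as the sum of the tails.
\<close>

lemma Kac_inequality:
  assumes "ergodic M f"
  shows "emeasure M UNIV \<le> (\<Sum>n. emeasure M (not_returned n))"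
proof -
  have "emeasure M UNIV = emeasure M (\<Union>n. first_entry Y n)"
  proof (rule emeasure_eq_AE)
    show "AE x in M. (x \<in> UNIV) = (x \<in> (\<Union>n. first_entry Y n))"
      using AE_visits_infinitely_often[OF assms]
    proof eventually_elim
      case (elim x)
      then have ex: "\<exists>k. (f ^^ k) x \<in> Y" by blast
      have "x \<in> first_entry Y (LEAST k. (f ^^ k) x \<in> Y)"
        using LeastI_ex[OF ex] not_less_Least[of _ "\<lambda>k. (f ^^ k) x \<in> Y"] by (auto simp: first_entry_def)
      then show ?case by blast
    qed
    show "UNIV \<in> sets M" using sets.top[of M] space_M by simp
  qed auto
  also have "\<dots> \<le> (\<Sum>n. emeasure M (first_entry Y n))"
    by (intro emeasure_subadditive_countably) auto
  finally show ?thesis by (simp add: emeasure_first_entry_Y)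
qed

end

lemma (in recurrent_domain) not_returned_AE_suplevel:
  "AE x in M. x \<in> not_returned n \<longrightarrow> x \<in> suplevel \<nu> (\<lambda>x. real (R x)) (Suc n)"
  using AE_not_in[OF never_returning_null]
proof eventually_elim
  case (elim x)
  show ?case
  proof
    assume x: "x \<in> not_returned n"
    then have Y: "x \<in> Y" by (simp add: not_returned_def)
    obtain i where "(f ^^ Suc i) x \<in> Y"
      using elim Y by (auto simp: not_returned_def simp del: funpow.simps)
    then obtain k where k: "x \<in> first_return Y k" using first_return_exists[of x "Suc i"] Y by blast
    then have "n \<le> k" using x by (auto simp: first_return_def not_returned_def not_less[symmetric] simp del: funpow.simps)
    then show "x \<in> suplevel \<nu> (\<lambda>x. real (R x)) (Suc n)"
      using return_time_first_return[OF k] Y by (simp add: suplevel_def space_induced)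
  qed
qed

text \<open>
  An exponent above 1 would make the return time integrable and the total mass finite.
\<close>

lemma return_exponent_le_1:
  fixes M :: "'a::metric_space measure"
  assumes "recurrent_domain M f Y" and "ergodic M f" and "emeasure M UNIV = \<infinity>"
    and reg: "asymptotically_regular (induced_measure M Y) (\<lambda>x. real (return_time f Y x)) \<alpha>"
  shows "\<alpha> \<le> 1"
proof (rule ccontr)
  interpret recurrent_domain M f Y by fact
  interpret \<nu>: prob_space \<nu> by (rule prob_space_induced)
  let ?A = "suplevel \<nu> (\<lambda>x. real (R x))"
  have A: "?A n \<in> sets \<nu>" for n using reg unfolding asymptotically_regular_def by blast
  assume "\<not> \<alpha> \<le> 1"
  then obtain a where a: "1 < a" "a < \<alpha>" using dense[of 1 \<alpha>] by auto
  have "\<forall>\<^sub>F n in sequentially. norm (measure \<nu> (?A (Suc n))) \<le> real (Suc n) powr (- a)"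
    using asymptotically_regular_upper[OF reg a(2), THEN eventually_sequentially_Suc[THEN iffD2]]
    by eventually_elim simp
  then have "summable (\<lambda>n. measure \<nu> (?A (Suc n)))"
    by (rule summable_comparison_test_ev)
      (use a summable_Suc_iff[of "\<lambda>j. real j powr (- a)"] in \<open>simp add: summable_real_powr_iff\<close>)
  then have "(\<Sum>n. ennreal (measure \<nu> (?A (Suc n)))) < \<infinity>"
    by (subst suminf_ennreal2) auto
  then have fin: "(\<Sum>n. emeasure \<nu> (?A (Suc n))) < \<infinity>"
    by (simp add: \<nu>.emeasure_eq_measure)
  have "emeasure M (not_returned n) \<le> emeasure M Y * emeasure \<nu> (?A (Suc n))" for n
  proof -
    have "?A (Suc n) \<in> sets M" using A by (simp add: sets_induced_iff)
    then have "emeasure M (not_returned n) \<le> emeasure M (?A (Suc n))"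
      by (intro emeasure_mono_AE not_returned_AE_suplevel)
    also have "\<dots> = emeasure M Y * emeasure \<nu> (?A (Suc n))"
      using Y_pos Y_finite
      by (simp add: emeasure_induced[OF A] ennreal_times_divide)
        (subst mult.commute, simp add: ennreal_mult_divide_eq)
    finally show ?thesis .
  qed
  then have "(\<Sum>n. emeasure M (not_returned n)) \<le> (\<Sum>n. emeasure M Y * emeasure \<nu> (?A (Suc n)))"
    by (intro suminf_le) auto
  also have "\<dots> < \<infinity>" using fin Y_finite by (simp add: ennreal_mult_less_top)
  finally show False using Kac_inequality[OF assms(2)] assms(3) by auto
qed


section \<open>Transfer to the return map\<close>

lemma regular_suplevelsD:
  assumes "regular_suplevels m \<phi> \<alpha>"
  shows "\<forall>n. suplevel m \<phi> n \<in> sets m"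
    and "(\<lambda>n. emeasure m (suplevel m \<phi> n)) \<longlonglongrightarrow> 0"
    and "\<exists>c>0. \<forall>\<^sub>F n in sequentially.
        measure m (suplevel m \<phi> (Suc n)) > c * measure m (suplevel m \<phi> n)"
    and "0 \<le> \<alpha>"
    and "(\<lambda>n. ln (measure m (suplevel m \<phi> n)) / (- ln (real n))) \<longlonglongrightarrow> \<alpha>"
    and "\<exists>\<beta>\<ge>0. \<exists>\<psi>. (\<exists>L. L-lipschitz_on (space m) \<psi>) \<and> (\<forall>x\<in>space m. 0 \<le> \<psi> x) \<and>
        (\<forall>n. emeasure m (suplevel m \<phi> n) < \<infinity> \<longrightarrow>
             suplevel m \<phi> n = {x \<in> space m. \<psi> x \<le> measure m (suplevel m \<phi> n) powr \<beta>})"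
  using assms unfolding regular_suplevels_def by simp_all

lemma regular_suplevels_tendsto_0:
  assumes "regular_suplevels m \<phi> \<alpha>"
  shows "(\<lambda>n. measure m (suplevel m \<phi> n)) \<longlonglongrightarrow> 0"
  using tendsto_enn2real[of "\<lambda>n. emeasure m (suplevel m \<phi> n)" 0] regular_suplevelsD(2)[OF assms]
  by (simp add: measure_def)

lemma regular_suplevels_imp_asymptotically_regular:
  assumes "prob_space m" and reg: "regular_suplevels m \<phi> \<alpha>"
  shows "asymptotically_regular m \<phi> \<alpha>"
proof -
  interpret prob_space m by fact
  have fin: "emeasure m A < \<infinity>" for A by (simp add: emeasure_eq_measure)
  obtain \<beta> \<psi> L where "\<beta> \<ge> 0" "L-lipschitz_on (space m) \<psi>"
    "\<And>n. suplevel m \<phi> n = {x \<in> space m. \<psi> x \<le> measure m (suplevel m \<phi> n) powr \<beta>}"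
    using regular_suplevelsD(6)[OF reg] fin by blast
  then have "\<exists>\<beta>\<ge>0. \<exists>\<psi>. (\<exists>L. L-lipschitz_on (space m) \<psi>) \<and> (\<forall>\<^sub>F n in sequentially.
      suplevel m \<phi> n = {x \<in> space m. \<psi> x \<le> measure m (suplevel m \<phi> n) powr \<beta>})"
    by (intro exI[of _ \<beta>] conjI exI[of _ \<psi>] exI[of _ L] always_eventually allI) blast+
  then show ?thesis
    unfolding asymptotically_regular_def
    using regular_suplevelsD(1,3,5)[OF reg] regular_suplevels_tendsto_0[OF reg] by (intro conjI)
qed

context recurrent_domain
begin

lemma AE_induced_returns:
  "AE x in \<nu>. x \<in> Y \<and> (\<forall>n. (T ^^ n) x \<in> Y \<and> (T ^^ n) x \<notin> (\<Inter>i. not_returned i))"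
proof -
  have "AE x in \<nu>. x \<notin> (\<Inter>n. not_returned n)"
    unfolding AE_induced_iff using AE_not_in[OF never_returning_null] by eventually_elim simp
  then have "AE x in \<nu>. \<forall>k. (T ^^ k) x \<notin> (\<Inter>n. not_returned n)"
    unfolding AE_all_countable
    using measure_preserving_AE[OF measure_preserving_funpow[OF return_map_preserving], of "\<lambda>x. x \<notin> (\<Inter>n. not_returned n)"]
    by blast
  then show ?thesis using AE_space
  proof eventually_elim
    case (elim x)
    then have "x \<in> Y" by (simp add: space_induced)
    moreover have "(T ^^ n) x \<in> Y" for n
      by (induction n) (use \<open>x \<in> Y\<close> return_map_mem in auto)
    ultimately show ?case using elim by blast
  qed
qed

lemma returns:
  assumes "x \<in> Y" "x \<notin> (\<Inter>i. not_returned i)"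
  obtains n where "x \<in> first_return Y n"
proof -
  obtain i where "(f ^^ Suc i) x \<in> Y"
    using assms by (auto simp: not_returned_def simp del: funpow.simps)
  then show ?thesis using first_return_exists[of x "Suc i"] assms that by blast
qed

lemma induced_map_eq_return_map:
  assumes "x \<in> Y" "x \<notin> (\<Inter>i. not_returned i)"
  shows "induced_map f Y x = T x"
proof -
  obtain n where n: "x \<in> first_return Y n" using returns[OF assms] .
  then have "(f ^^ Suc n) x \<in> Y" by (simp add: first_return_def del: funpow.simps)
  then have "\<exists>n>0. (f ^^ n) x \<in> Y" by blast
  then show ?thesis by (simp add: return_map_def)
qed

lemma funpow_induced_map_eq:
  assumes "\<And>n. (T ^^ n) x \<in> Y \<and> (T ^^ n) x \<notin> (\<Inter>i. not_returned i)"
  shows "(induced_map f Y ^^ n) x = (T ^^ n) x"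
proof (induction n)
  case (Suc n)
  then show ?case using induced_map_eq_return_map[of "(T ^^ n) x"] assms[of n] by simp
qed simp

end

text \<open>
  Beyond the bound of \<open>\<phi>\<close> outside \<open>Y\<close> the suplevels in \<open>M\<close> and in the induced system are the same sets, and
  their measures differ by the factor \<open>\<mu>(Y)\<close>. This factor disappears from the logarithmic limit and
  is absorbed into the Lipschitz function.
\<close>

lemma asymptotically_regular_induced:
  fixes M :: "'a::metric_space measure"
  assumes "recurrent_domain M f Y"
    and reg: "regular_suplevels M \<phi> \<alpha>" and bdd: "bdd_above (\<phi> ` (- Y))"
  shows "asymptotically_regular (induced_measure M Y) \<phi> \<alpha>"
proof -
  interpret recurrent_domain M f Y by fact
  let ?A = "suplevel M \<phi>" and ?B = "suplevel \<nu> \<phi>"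
  define y where "y = measure M Y"
  have y: "0 < y" "emeasure M Y = ennreal y"
    using Y_pos Y_finite by (auto simp: y_def measure_def enn2real_positive_iff)
  have A[measurable]: "?A n \<in> sets M" for n using regular_suplevelsD(1)[OF reg] by blast
  have B: "?B n = ?A n \<inter> Y" for n by (auto simp: suplevel_def space_induced space_M)
  obtain K where K: "\<And>x. x \<notin> Y \<Longrightarrow> \<phi> x \<le> K" using bdd by (auto simp: bdd_above_def)
  obtain n0 :: nat where n0: "K < real n0" using reals_Archimedean2 by blast
  have AY: "?A n \<subseteq> Y" if "n \<ge> n0" for n
    using K n0 that by (force simp: suplevel_def not_less[symmetric])
  have BA: "?B n = ?A n" "emeasure M (?A n) < \<infinity>" "measure \<nu> (?B n) = measure M (?A n) / y" if "n \<ge> n0" for n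
  proof -
    show 1: "?B n = ?A n" using B AY[OF that] by auto
    show 2: "emeasure M (?A n) < \<infinity>"
      using emeasure_subset_finite[OF AY[OF that]] by (simp add: less_top)
    have "emeasure \<nu> (?B n) = emeasure M (?A n) / emeasure M Y"
      using AY[OF that] unfolding 1 by (intro emeasure_induced) (simp add: sets_induced_iff)
    also have "\<dots> = ennreal (measure M (?A n)) / ennreal y"
      using 2 y by (simp add: emeasure_eq_ennreal_measure)
    also have "\<dots> = ennreal (measure M (?A n) / y)" using y by (simp add: divide_ennreal)
    finally show "measure \<nu> (?B n) = measure M (?A n) / y"
      using y by (simp add: measure_def[of \<nu>])
  qed
  have ev: "\<forall>\<^sub>F n in sequentially. n \<ge> n0" by (rule eventually_ge_at_top)
  obtain c where c: "c > 0" "\<forall>\<^sub>F n in sequentially. measure M (?A (Suc n)) > c * measure M (?A n)"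
    using regular_suplevelsD(3)[OF reg] by blast
  have cB: "\<forall>\<^sub>F n in sequentially. measure \<nu> (?B (Suc n)) > c * measure \<nu> (?B n)"
    using c(2) ev
  proof eventually_elim
    case (elim n)
    then show ?case using BA(3)[of n] BA(3)[of "Suc n"] y by (simp add: divide_strict_right_mono)
  qed
  have pos: "\<forall>\<^sub>F n in sequentially. 0 < measure M (?A n)"
  proof -
    have "\<forall>\<^sub>F n in sequentially. 0 < measure M (?A (Suc n))"
      using c(2) by (elim eventually_mono)
        (use c(1) in \<open>meson less_eq_real_def measure_nonneg mult_nonneg_nonneg order_le_less_trans\<close>)
    then show ?thesis by (subst (asm) eventually_sequentially_Suc)
  qed
  have "(\<lambda>n. measure M (?A n) / y) \<longlonglongrightarrow> 0 / y"
    using y by (intro tendsto_divide regular_suplevels_tendsto_0[OF reg] tendsto_const) auto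
  then have "(\<lambda>n. measure M (?A n) / y) \<longlonglongrightarrow> 0" by simp
  then have limB: "(\<lambda>n. measure \<nu> (?B n)) \<longlonglongrightarrow> 0"
    by (rule Lim_transform_eventually) (use ev in \<open>eventually_elim, simp only: BA(3)\<close>)
  have "(\<lambda>n. - (ln y / - ln (real n))) \<longlonglongrightarrow> - 0"
  proof (intro tendsto_minus)
    have "filterlim (\<lambda>n. ln (real n)) at_top sequentially"
      by (intro filterlim_compose[OF ln_at_top] filterlim_real_sequentially)
    then have "(\<lambda>n. ln y / ln (real n)) \<longlonglongrightarrow> 0"
      by (intro tendsto_divide_0[OF tendsto_const] filterlim_at_top_imp_at_infinity)
    then show "(\<lambda>n. ln y / - ln (real n)) \<longlonglongrightarrow> 0" using tendsto_minus by fastforce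
  qed
  then have "(\<lambda>n. ln (measure M (?A n)) / (- ln (real n)) + - (ln y / - ln (real n))) \<longlonglongrightarrow> \<alpha> + - 0"
    by (intro tendsto_add regular_suplevelsD(5)[OF reg])
  then have "(\<lambda>n. ln (measure M (?A n)) / (- ln (real n)) + - (ln y / - ln (real n))) \<longlonglongrightarrow> \<alpha>"
    by (simp only: minus_zero add_0_right)
  then have expB: "(\<lambda>n. ln (measure \<nu> (?B n)) / (- ln (real n))) \<longlonglongrightarrow> \<alpha>"
  proof (rule Lim_transform_eventually)
    show "\<forall>\<^sub>F n in sequentially. ln (measure M (?A n)) / (- ln (real n)) + - (ln y / - ln (real n)) = ln (measure \<nu> (?B n)) / (- ln (real n))"
      using pos ev
    proof eventually_elim
      case (elim n)
      then show ?case using y BA(3)[of n] by (simp add: ln_div diff_divide_distrib)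
    qed
  qed
  obtain \<beta> \<psi> L where \<beta>: "\<beta> \<ge> 0" and L: "L-lipschitz_on (space M) \<psi>"
    and \<psi>: "\<And>n. emeasure M (?A n) < \<infinity> \<Longrightarrow> ?A n = {x \<in> space M. \<psi> x \<le> measure M (?A n) powr \<beta>}"
    using regular_suplevelsD(6)[OF reg] by blast
  define \<psi>' where "\<psi>' = (\<lambda>x. 1 / y powr \<beta> * \<psi> x)"
  have lip: "(\<bar>1 / y powr \<beta>\<bar> * L)-lipschitz_on (space \<nu>) \<psi>'"
    unfolding \<psi>'_def space_induced
    by (rule lipschitz_on_cmult_real, rule lipschitz_on_subset[OF L]) (simp add: space_M)
  have "?B n = {x \<in> space \<nu>. \<psi>' x \<le> measure \<nu> (?B n) powr \<beta>}" if n: "n \<ge> n0" for n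
  proof -
    have "\<psi>' x \<le> measure \<nu> (?B n) powr \<beta> \<longleftrightarrow> \<psi> x \<le> measure M (?A n) powr \<beta>" for x
      using y by (simp add: BA(3)[OF n] \<psi>'_def powr_divide divide_le_cancel)
    then show ?thesis using \<psi>[OF BA(2)[OF n]] AY[OF n] unfolding BA(1)[OF n] space_induced space_M by blast
  qed
  then have lipB: "\<forall>\<^sub>F n in sequentially. ?B n = {x \<in> space \<nu>. \<psi>' x \<le> measure \<nu> (?B n) powr \<beta>}"
    unfolding eventually_sequentially by blast
  have "?B n \<in> sets \<nu>" for n unfolding B by (simp add: sets_induced_iff)
  moreover have "\<exists>\<beta>\<ge>0. \<exists>\<psi>. (\<exists>L. L-lipschitz_on (space \<nu>) \<psi>) \<and>
      (\<forall>\<^sub>F n in sequentially. ?B n = {x \<in> space \<nu>. \<psi> x \<le> measure \<nu> (?B n) powr \<beta>})"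
    by (rule exI[of _ \<beta>], intro conjI \<beta>, rule exI[of _ \<psi>'], intro conjI lipB, rule exI, rule lip)
  ultimately show ?thesis
    unfolding asymptotically_regular_def using cB c(1) limB expB by blast
qed

lemma continuous_on_measurable_induced:
  fixes M :: "'a::metric_space measure" and u :: "'a \<Rightarrow> real"
  assumes "recurrent_domain M f Y" "sets borel \<subseteq> sets M" "continuous_on (space (induced_measure M Y)) u"
  shows "u \<in> borel_measurable (induced_measure M Y)"
proof (rule measurableI)
  interpret recurrent_domain M f Y by fact
  fix A :: "real set" assume A: "A \<in> sets borel"
  have "u \<in> borel_measurable (restrict_space borel Y)"
    using assms(3) unfolding space_induced by (rule borel_measurable_continuous_on_restrict)
  then have "u -` A \<inter> Y \<in> sets (restrict_space borel Y)"
    using measurable_sets[of u "restrict_space borel Y" borel A] A by (simp add: space_restrict_space)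
  then obtain B where "B \<in> sets borel" "u -` A \<inter> Y = Y \<inter> B"
    by (auto simp: sets_restrict_space)
  then show "u -` A \<inter> space \<nu> \<in> sets \<nu>"
    using assms(2) Y_sets unfolding space_induced by (auto simp: sets_induced_iff)
qed simp

lemma SPDC_return_map:
  fixes M :: "'a::metric_space measure"
  assumes "recurrent_domain M f Y" "sets borel \<subseteq> sets M"
    and decay: "SPDC (induced_measure M Y) (induced_map f Y)"
  shows "SPDC (induced_measure M Y) (recurrent_domain.return_map f Y)"
proof -
  interpret recurrent_domain M f Y by fact
  obtain \<Theta> :: "nat \<Rightarrow> real" where \<Theta>: "\<forall>a>0. (\<lambda>n. real n powr a * \<Theta> n) \<longlonglongrightarrow> 0"
    and dec: "\<And>g h n. bounded_lipschitz_on (space \<nu>) g \<Longrightarrow> bounded_lipschitz_on (space \<nu>) h \<Longrightarrow>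
        \<bar>(\<integral>x. g ((induced_map f Y ^^ n) x) * h x \<partial>\<nu>) - (\<integral>x. g x \<partial>\<nu>) * (\<integral>x. h x \<partial>\<nu>)\<bar>
              \<le> lipschitz_norm (space \<nu>) g * lipschitz_norm (space \<nu>) h * \<Theta> n"
    using decay unfolding SPDC_def by blast
  have "\<bar>(\<integral>x. g ((T ^^ n) x) * h x \<partial>\<nu>) - (\<integral>x. g x \<partial>\<nu>) * (\<integral>x. h x \<partial>\<nu>)\<bar>
      \<le> lipschitz_norm (space \<nu>) g * lipschitz_norm (space \<nu>) h * \<Theta> n"
    if g: "bounded_lipschitz_on (space \<nu>) g" and h: "bounded_lipschitz_on (space \<nu>) h" for g h n
  proof -
    \<comment> \<open>Off \<open>Y\<close> the function \<open>g\<close> is arbitrary, but the iterates of \<open>induced_map\<close> may leave \<open>Y\<close>;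
      cutting \<open>g\<close> off keeps the integrand measurable.\<close>
    define g0 where "g0 = (\<lambda>x. if x \<in> Y then g x else 0)"
    have g0: "\<And>x. x \<in> space \<nu> \<Longrightarrow> g0 x = g x" by (simp add: g0_def space_induced)
    have meas: "u \<in> borel_measurable \<nu>" if "bounded_lipschitz_on (space \<nu>) u" for u
      using that lipschitz_on_continuous_on continuous_on_measurable_induced[OF assms(1,2)]
      unfolding bounded_lipschitz_on_def by blast
    have gm: "g \<in> borel_measurable \<nu>" and hm: "h \<in> borel_measurable \<nu>" using meas g h by blast+
    have "g \<in> borel_measurable (restrict_space M Y)"
      using gm measurable_cong_sets[OF sets_induced refl] by blast
    then have g0m: "g0 \<in> borel_measurable M"
      unfolding g0_def by (subst (asm) measurable_restrict_space_iff[where c=0]) (auto simp: space_M)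
    have "image g0 (space \<nu>) = image g (space \<nu>)" using g0 by (rule image_cong[OF refl])
    moreover have lipeq: "L-lipschitz_on (space \<nu>) g0 \<longleftrightarrow> L-lipschitz_on (space \<nu>) g" for L
      using g0 by (rule lipschitz_on_cong[OF refl refl])
    ultimately have "bounded_lipschitz_on (space \<nu>) g0"
      using g unfolding bounded_lipschitz_on_def by simp
    from dec[OF this h] have
      "\<bar>(\<integral>x. g0 ((induced_map f Y ^^ n) x) * h x \<partial>\<nu>) - (\<integral>x. g0 x \<partial>\<nu>) * (\<integral>x. h x \<partial>\<nu>)\<bar>
        \<le> lipschitz_norm (space \<nu>) g0 * lipschitz_norm (space \<nu>) h * \<Theta> n" .
    moreover have "lipschitz_norm (space \<nu>) g0 = lipschitz_norm (space \<nu>) g"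
      unfolding lipschitz_norm_def lipeq using g0 by simp
    moreover have "(\<integral>x. g0 x \<partial>\<nu>) = (\<integral>x. g x \<partial>\<nu>)"
      using g0 by (intro Bochner_Integration.integral_cong) auto
    moreover have "(\<integral>x. g0 ((induced_map f Y ^^ n) x) * h x \<partial>\<nu>) = (\<integral>x. g ((T ^^ n) x) * h x \<partial>\<nu>)"
    proof (rule integral_cong_AE)
      have "(induced_map f Y ^^ n) \<in> M \<rightarrow>\<^sub>M M" by (induction n) (auto intro: measurable_comp)
      then have "(\<lambda>x. g0 ((induced_map f Y ^^ n) x)) \<in> borel_measurable M"
        using g0m by (rule measurable_compose)
      then show "(\<lambda>x. g0 ((induced_map f Y ^^ n) x) * h x) \<in> borel_measurable \<nu>"
        using hm measurable_induced by (intro borel_measurable_times)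
      have "(T ^^ n) \<in> \<nu> \<rightarrow>\<^sub>M \<nu>"
        using measure_preserving_funpow[OF return_map_preserving] by (simp add: measure_preserving_map_def)
      then show "(\<lambda>x. g ((T ^^ n) x) * h x) \<in> borel_measurable \<nu>"
        using hm gm by (intro borel_measurable_times measurable_compose[OF _ gm])
      show "AE x in \<nu>. g0 ((induced_map f Y ^^ n) x) * h x = g ((T ^^ n) x) * h x"
        using AE_induced_returns
      proof eventually_elim
        case (elim x)
        then have "(induced_map f Y ^^ n) x = (T ^^ n) x" "(T ^^ n) x \<in> Y"
          using funpow_induced_map_eq[of x n] by blast+
        then show ?case by (simp add: g0_def)
      qed
    qed
    ultimately show ?thesis by simp
  qed
  then show ?thesis unfolding SPDC_def using \<Theta> by blast
qed


section \<open>From the return map to the original system\<close>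

text \<open>
  Both growth conditions survive passing from a point of an orbit back to an earlier one, so it
  suffices to prove them on \<open>Y\<close>. They determine the exponent of the running maximum.
\<close>

definition growth_at_most :: "('a \<Rightarrow> 'a) \<Rightarrow> ('a \<Rightarrow> real) \<Rightarrow> real \<Rightarrow> 'a \<Rightarrow> bool" where
  "growth_at_most f \<phi> \<gamma> x \<longleftrightarrow> (\<exists>C. \<forall>k. \<phi> ((f ^^ k) x) \<le> C * real (Suc k) powr \<gamma>)"

definition growth_at_least :: "('a \<Rightarrow> 'a) \<Rightarrow> ('a \<Rightarrow> real) \<Rightarrow> real \<Rightarrow> 'a \<Rightarrow> bool" where
  "growth_at_least f \<phi> \<gamma> x \<longleftrightarrow>
    (\<exists>c>0. \<forall>\<^sub>F n in sequentially. \<exists>k<n. c * real n powr \<gamma> \<le> \<phi> ((f ^^ k) x))"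

lemma growth_at_most_funpow:
  assumes "growth_at_most f \<phi> \<gamma> ((f ^^ j) x)" "0 \<le> \<gamma>"
  shows "growth_at_most f \<phi> \<gamma> x"
proof -
  obtain C where C: "\<And>k. \<phi> ((f ^^ k) ((f ^^ j) x)) \<le> C * real (Suc k) powr \<gamma>"
    using assms(1) unfolding growth_at_most_def by blast
  define K where "K = \<bar>C\<bar> + (\<Sum>i<j. \<bar>\<phi> ((f ^^ i) x)\<bar>)"
  have K: "\<bar>C\<bar> \<le> K" "0 \<le> K" by (auto simp: K_def intro!: sum_nonneg)
  have "\<phi> ((f ^^ k) x) \<le> K * real (Suc k) powr \<gamma>" for k
  proof (cases "k < j")
    case True
    have "\<phi> ((f ^^ k) x) \<le> \<bar>\<phi> ((f ^^ k) x)\<bar>" by simp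
    also have "\<dots> \<le> (\<Sum>i<j. \<bar>\<phi> ((f ^^ i) x)\<bar>)"
      using True by (intro member_le_sum) auto
    also have "\<dots> \<le> K * 1" by (simp add: K_def)
    also have "\<dots> \<le> K * real (Suc k) powr \<gamma>"
      using K assms(2) by (intro mult_left_mono ge_one_powr_ge_zero) auto
    finally show ?thesis .
  next
    case False
    then have "(f ^^ k) x = (f ^^ (k - j)) ((f ^^ j) x)"
      by (simp add: funpow_add[symmetric, THEN fun_cong, unfolded comp_def])
    then have "\<phi> ((f ^^ k) x) \<le> C * real (Suc (k - j)) powr \<gamma>" using C by simp
    also have "\<dots> \<le> K * real (Suc k) powr \<gamma>"
      using K assms(2) by (intro mult_mono powr_mono2) auto
    finally show ?thesis .
  qed
  then show ?thesis unfolding growth_at_most_def by blast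
qed

lemma growth_at_least_funpow:
  assumes "growth_at_least f \<phi> \<gamma> ((f ^^ j) x)" "0 \<le> \<gamma>"
  shows "growth_at_least f \<phi> \<gamma> x"
proof -
  obtain c N where c: "c > 0" and
    N: "\<And>n. n \<ge> N \<Longrightarrow> \<exists>k<n. c * real n powr \<gamma> \<le> \<phi> ((f ^^ k) ((f ^^ j) x))"
    using assms(1) unfolding growth_at_least_def eventually_sequentially by blast
  have "\<exists>k<n. c * (1 / 2) powr \<gamma> * real n powr \<gamma> \<le> \<phi> ((f ^^ k) x)" if n: "n \<ge> N + 2 * j" for n
  proof -
    have "N \<le> n - j" using n by linarith
    then obtain k where k: "k < n - j" "c * real (n - j) powr \<gamma> \<le> \<phi> ((f ^^ k) ((f ^^ j) x))"
      using N by blast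
    have "c * (1 / 2) powr \<gamma> * real n powr \<gamma> = c * (1 / 2 * real n) powr \<gamma>"
      by (subst powr_mult) auto
    also have "\<dots> \<le> c * real (n - j) powr \<gamma>"
      using c n assms(2) by (intro mult_left_mono powr_mono2) auto
    also have "\<dots> \<le> \<phi> ((f ^^ (k + j)) x)" using k(2) by (simp add: funpow_add)
    finally show ?thesis using k(1) by (intro exI[of _ "k + j"]) auto
  qed
  then show ?thesis unfolding growth_at_least_def eventually_sequentially
    using c by (intro exI[of _ "c * (1 / 2) powr \<gamma>"] conjI) (simp, blast)
qed

context recurrent_domain
begin

definition visit_time :: "nat \<Rightarrow> 'a \<Rightarrow> nat" where
  "visit_time n x = (\<Sum>k<n. R ((T ^^ k) x))"

definition always_returns :: "'a \<Rightarrow> bool" where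
  "always_returns x \<longleftrightarrow> (\<forall>n. (T ^^ n) x \<in> Y \<and> (T ^^ n) x \<notin> (\<Inter>i. not_returned i))"

lemma return_time_first_visit:
  assumes "x \<in> Y" "x \<notin> (\<Inter>i. not_returned i)"
  shows "0 < R x" "(f ^^ R x) x = T x" "\<And>k. 0 < k \<Longrightarrow> k < R x \<Longrightarrow> (f ^^ k) x \<notin> Y"
proof -
  obtain n where n: "x \<in> first_return Y n" using returns[OF assms] .
  note R = return_time_first_return[OF n]
  show "0 < R x" using R by simp
  show "(f ^^ R x) x = T x" using R return_map_first_return[OF n] by simp
  show "(f ^^ k) x \<notin> Y" if k: "0 < k" "k < R x" for k
  proof -
    obtain i where i: "k = Suc i" using k(1) by (cases k) auto
    then have "i < n" using k(2) R by linarith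
    then show ?thesis using n unfolding first_return_def i by blast
  qed
qed

lemma strict_mono_visit_time:
  assumes "always_returns x" shows "strict_mono (\<lambda>n. visit_time n x)"
proof (rule strict_mono_Suc_iff[THEN iffD2], rule allI)
  fix n
  have "0 < R ((T ^^ n) x)"
    using assms return_time_first_visit(1) unfolding always_returns_def by blast
  then show "visit_time n x < visit_time (Suc n) x" by (simp add: visit_time_def)
qed

lemma funpow_visit_time:
  assumes "always_returns x" shows "(f ^^ visit_time n x) x = (T ^^ n) x"
proof (induction n)
  case 0
  show ?case by (simp add: visit_time_def)
next
  case (Suc n)
  have "visit_time (Suc n) x = R ((T ^^ n) x) + visit_time n x" by (simp add: visit_time_def)
  then have "(f ^^ visit_time (Suc n) x) x = (f ^^ R ((T ^^ n) x)) ((T ^^ n) x)"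
    using Suc by (simp add: funpow_add)
  also have "\<dots> = T ((T ^^ n) x)"
    using assms return_time_first_visit(2) unfolding always_returns_def by blast
  finally show ?case by simp
qed

lemma visit_is_visit_time:
  assumes x: "always_returns x" and k: "(f ^^ k) x \<in> Y"
  shows "\<exists>n. k = visit_time n x"
proof -
  define n where "n = (LEAST n. k < visit_time (Suc n) x)"
  have "k < visit_time (Suc k) x"
    using strict_mono_imp_increasing[OF strict_mono_visit_time[OF x], of "Suc k"] by simp
  then have n: "k < visit_time (Suc n) x" unfolding n_def by (rule LeastI)
  have le: "visit_time n x \<le> k"
  proof (cases n)
    case 0
    then show ?thesis by (simp add: visit_time_def)
  next
    case (Suc i)
    then show ?thesis using not_less_Least[of i "\<lambda>n. k < visit_time (Suc n) x"]
      unfolding n_def[symmetric] by simp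
  qed
  have "k = visit_time n x"
  proof (rule ccontr)
    assume "k \<noteq> visit_time n x"
    then have "0 < k - visit_time n x" "k - visit_time n x < R ((T ^^ n) x)"
      using le n by (auto simp: visit_time_def)
    then have "(f ^^ (k - visit_time n x)) ((T ^^ n) x) \<notin> Y"
      using x return_time_first_visit(3) unfolding always_returns_def by blast
    moreover have "(f ^^ (k - visit_time n x)) ((T ^^ n) x) = (f ^^ k) x"
    proof -
      have "(f ^^ k) x = (f ^^ ((k - visit_time n x) + visit_time n x)) x" using le by simp
      then show ?thesis by (simp only: funpow_add comp_apply funpow_visit_time[OF x])
    qed
    ultimately show False using k by simp
  qed
  then show ?thesis by blast
qed

end


context recurrent_domain
begin

text \<open>
  Because \<open>S\<^sub>j\<close> dominates the maximum of the first \<open>j\<close> return times, it is at least \<open>j\<^sup>t\<close>. So a visit at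
  time \<open>k = S\<^sub>j\<close> has \<open>j = O(k\<^sup>1\<^sup>/\<^sup>t)\<close>, and the value of \<open>\<phi>\<close> there is \<open>O(j\<^sup>s) = O(k\<^sup>s\<^sup>/\<^sup>t)\<close>.
\<close>

lemma growth_at_most_of_induced:
  fixes \<phi> :: "'a \<Rightarrow> real"
  assumes x: "always_returns x"
    and out: "\<And>y. y \<notin> Y \<Longrightarrow> \<phi> y \<le> K"
    and phi: "\<forall>\<^sub>F j in sequentially. \<phi> ((T ^^ j) x) < real (Suc j) powr s"
    and ret: "\<forall>\<^sub>F n in sequentially. \<exists>i<n. real n powr t \<le> real (R ((T ^^ i) x))"
    and s: "0 < s" and t: "0 < t"
  shows "growth_at_most f \<phi> (s / t) x"
proof -
  obtain J where J: "\<And>j. j \<ge> J \<Longrightarrow> \<phi> ((T ^^ j) x) < real (Suc j) powr s"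
    using phi by (auto simp: eventually_sequentially)
  obtain N where N: "\<And>n. n \<ge> N \<Longrightarrow> \<exists>i<n. real n powr t \<le> real (R ((T ^^ i) x))"
    using ret by (auto simp: eventually_sequentially)
  define C1 where "C1 = (\<Sum>j<J. \<bar>\<phi> ((T ^^ j) x)\<bar>)"
  have C1: "0 \<le> C1" by (auto simp: C1_def intro!: sum_nonneg)
  have phi_le: "\<phi> ((T ^^ j) x) \<le> C1 + real (Suc j) powr s" for j
  proof (cases "j < J")
    case True
    have "\<phi> ((T ^^ j) x) \<le> \<bar>\<phi> ((T ^^ j) x)\<bar>" by simp
    also have "\<dots> \<le> C1" unfolding C1_def using True by (intro member_le_sum) auto
    finally show ?thesis by (meson add_increasing2 powr_ge_zero)
  next
    case False
    then show ?thesis using J[of j] C1 by simp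
  qed
  define D where "D = real N + 2"
  have j_le: "real (Suc j) \<le> D * real (Suc (visit_time j x)) powr (1 / t)" for j
  proof -
    have v1: "1 \<le> real (Suc (visit_time j x)) powr (1 / t)"
      using t by (intro ge_one_powr_ge_zero) auto
    have "real (Suc j) \<le> real N + 1 + real (Suc (visit_time j x)) powr (1 / t)"
    proof (cases "j \<ge> N")
      case True
      then obtain i where i: "i < j" "real j powr t \<le> real (R ((T ^^ i) x))" using N by blast
      have "R ((T ^^ i) x) \<le> visit_time j x"
        unfolding visit_time_def using i(1) by (intro member_le_sum) auto
      then have "real j powr t \<le> real (Suc (visit_time j x))" using i(2) by simp
      then have "(real j powr t) powr (1 / t) \<le> real (Suc (visit_time j x)) powr (1 / t)"
        using t by (intro powr_mono2) auto
      then show ?thesis using t by (simp add: powr_powr)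
    qed (use v1 in simp)
    also have "\<dots> \<le> D * real (Suc (visit_time j x)) powr (1 / t)"
      using mult_left_mono[OF v1, of "real N + 1"] by (simp add: D_def distrib_right)
    finally show ?thesis .
  qed
  have "\<phi> ((f ^^ k) x) \<le> (\<bar>K\<bar> + C1 + D powr s) * real (Suc k) powr (s / t)" for k
  proof -
    have k1: "1 \<le> real (Suc k) powr (s / t)" using s t by (intro ge_one_powr_ge_zero) auto
    have base: "u \<le> u * real (Suc k) powr (s / t)" if "0 \<le> u" for u
      using mult_left_mono[OF k1 that] by simp
    have D0: "0 < D" by (simp add: D_def)
    show ?thesis
    proof (cases "(f ^^ k) x \<in> Y")
      case False
      then have "\<phi> ((f ^^ k) x) \<le> \<bar>K\<bar> + C1 + D powr s" using out[of "(f ^^ k) x"] C1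
        by (smt (verit) powr_ge_zero)
      also have "\<dots> \<le> (\<bar>K\<bar> + C1 + D powr s) * real (Suc k) powr (s / t)"
        using C1 by (intro base) auto
      finally show ?thesis .
    next
      case True
      then obtain j where j: "k = visit_time j x" using visit_is_visit_time[OF x] by blast
      then have "\<phi> ((f ^^ k) x) \<le> C1 + real (Suc j) powr s"
        using phi_le[of j] funpow_visit_time[OF x, of j] by simp
      also have "real (Suc j) powr s \<le> (D * real (Suc k) powr (1 / t)) powr s"
        using j_le[of j] s unfolding j by (intro powr_mono2) auto
      also have "\<dots> = D powr s * real (Suc k) powr (s / t)"
        using D0 by (simp add: powr_mult powr_powr)
      also have "C1 + D powr s * real (Suc k) powr (s / t)
          \<le> (\<bar>K\<bar> + C1 + D powr s) * real (Suc k) powr (s / t)"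
        using base[of "\<bar>K\<bar> + C1"] C1 by (simp add: distrib_right)
      finally show ?thesis by simp
    qed
  qed
  then show ?thesis unfolding growth_at_most_def by blast
qed

text \<open>
  About \<open>j = (n/C)\<^sup>1\<^sup>/\<^sup>u\<close> visits to \<open>Y\<close> fit into \<open>n\<close> steps, and among the first \<open>j\<close> of them the value
  \<open>j\<^sup>w\<close> is reached.
\<close>

lemma growth_at_least_of_induced:
  fixes \<phi> :: "'a \<Rightarrow> real"
  assumes x: "always_returns x"
    and phi: "\<forall>\<^sub>F n in sequentially. \<exists>i<n. real n powr w \<le> \<phi> ((T ^^ i) x)"
    and sums: "\<exists>C>0. \<forall>n. real (\<Sum>k<n. R ((T ^^ k) x)) \<le> C * real n powr u"
    and w: "0 < w" and u: "0 < u"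
  shows "growth_at_least f \<phi> (w / u) x"
proof -
  obtain N where N: "\<And>n. n \<ge> N \<Longrightarrow> \<exists>i<n. real n powr w \<le> \<phi> ((T ^^ i) x)"
    using phi by (auto simp: eventually_sequentially)
  obtain C where C: "C > 0" "\<And>n. real (visit_time n x) \<le> C * real n powr u"
    using sums unfolding visit_time_def by blast
  define c where "c = (1 / 2) powr w * C powr (- (w / u))"
  have c: "c > 0" using C by (simp add: c_def)
  have "\<exists>k<n. c * real n powr (w / u) \<le> \<phi> ((f ^^ k) x)"
    if n: "C * (real N + 1) powr u \<le> real n" for n
  proof -
    define z where "z = (real n / C) powr (1 / u)"
    have "((real N + 1) powr u) powr (1 / u) \<le> z"
      unfolding z_def using n C u by (intro powr_mono2) (auto simp: field_simps)
    then have z: "real N + 1 \<le> z" using u by (simp add: powr_powr)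
    have "int N + 1 \<le> \<lfloor>z\<rfloor>" using z by (simp add: le_floor_iff)
    define j where "j = nat \<lfloor>z\<rfloor>"
    have j: "real j \<le> z" "z / 2 \<le> real j" "N \<le> j"
      using z \<open>int N + 1 \<le> \<lfloor>z\<rfloor>\<close> unfolding j_def by linarith+
    obtain i where i: "i < j" "real j powr w \<le> \<phi> ((T ^^ i) x)" using N[OF j(3)] by blast
    have "visit_time i x < visit_time j x"
      using strict_monoD[OF strict_mono_visit_time[OF x] i(1)] .
    moreover have "real (visit_time j x) \<le> real n"
    proof -
      have "real (visit_time j x) \<le> C * real j powr u" by (rule C)
      also have "\<dots> \<le> C * z powr u" using C j u by (intro mult_left_mono powr_mono2) auto
      also have "\<dots> = real n" using C u by (simp add: z_def powr_powr)
      finally show ?thesis .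
    qed
    ultimately have "visit_time i x < n" by simp
    moreover have "c * real n powr (w / u) \<le> \<phi> ((f ^^ visit_time i x) x)"
    proof -
      have "c * real n powr (w / u) = (z / 2) powr w"
      proof -
        have "z powr w = (real n / C) powr (w / u)" by (simp add: z_def powr_powr)
        then have "z powr w = C powr (- (w / u)) * real n powr (w / u)"
          using C(1) by (simp add: powr_divide powr_minus_divide)
        moreover have "(1 / 2 * z) powr w = (1 / 2) powr w * z powr w"
          by (rule powr_mult)
        ultimately show ?thesis by (simp add: c_def)
      qed
      also have "\<dots> \<le> real j powr w" using j z w by (intro powr_mono2) auto
      also have "\<dots> \<le> \<phi> ((f ^^ visit_time i x) x)" using i(2) funpow_visit_time[OF x] by simp
      finally show ?thesis .
    qed
    ultimately show ?thesis by blast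
  qed
  moreover have "\<forall>\<^sub>F n in sequentially. C * (real N + 1) powr u \<le> real n"
    using filterlim_real_sequentially by (simp add: filterlim_at_top)
  ultimately have "\<forall>\<^sub>F n in sequentially. \<exists>k<n. c * real n powr (w / u) \<le> \<phi> ((f ^^ k) x)"
    by (auto elim: eventually_mono)
  then show ?thesis unfolding growth_at_least_def using c by blast
qed

lemma growth_at_least_0_of_induced:
  fixes \<phi> :: "'a \<Rightarrow> real"
  assumes x: "always_returns x"
    and phi: "\<forall>\<^sub>F n in sequentially. \<exists>i<n. real n powr w \<le> \<phi> ((T ^^ i) x)"
    and w: "0 < w"
  shows "growth_at_least f \<phi> 0 x"
proof -
  have "\<forall>\<^sub>F n in sequentially. 1 \<le> n \<and> (\<exists>i<n. real n powr w \<le> \<phi> ((T ^^ i) x))"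
    using eventually_ge_at_top[of 1] phi by eventually_elim simp
  then obtain n where "1 \<le> n" "\<exists>i<n. real n powr w \<le> \<phi> ((T ^^ i) x)"
    unfolding eventually_sequentially by blast
  moreover from this have "1 \<le> real n powr w" using w by (intro ge_one_powr_ge_zero) auto
  ultimately obtain i where "1 \<le> \<phi> ((f ^^ visit_time i x) x)"
    using funpow_visit_time[OF x] by (metis order_trans)
  then have "\<exists>k<n. 1 * real n powr 0 \<le> \<phi> ((f ^^ k) x)" if "n \<ge> Suc (visit_time i x)" for n
    using that by (intro exI[of _ "visit_time i x"]) auto
  then show ?thesis unfolding growth_at_least_def eventually_sequentially
    by (intro exI[of _ 1]) auto
qed

text \<open>
  Almost every orbit enters \<open>Y\<close>, and by invariance almost none enters through an exceptional null set.
\<close>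

lemma AE_of_induced:
  assumes "ergodic M f" and P: "AE x in \<nu>. P x" and inv: "\<And>k x. P ((f ^^ k) x) \<Longrightarrow> P x"
  shows "AE x in M. P x"
proof -
  have "AE x in M. x \<in> Y \<longrightarrow> P x" using P by (simp add: AE_induced_iff)
  then have "AE x in M. \<forall>k. (f ^^ k) x \<in> Y \<longrightarrow> P ((f ^^ k) x)"
    unfolding AE_all_countable
    using measure_preserving_AE[OF measure_preserving_funpow[OF preserving], of "\<lambda>x. x \<in> Y \<longrightarrow> P x"] by blast
  then show ?thesis using AE_visits_infinitely_often[OF assms(1)]
    by eventually_elim (use inv in blast)
qed

end

text \<open>
  Rational exponents suffice and can be handled by countably many exceptional sets. Exponent 0 is a
  separate hypothesis because it is the lower bound needed when the limit itself is 0.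
\<close>

lemma running_max_exponent:
  fixes L :: ereal
  assumes nonneg: "\<And>x. 0 \<le> \<phi> x" and L: "0 \<le> L"
    and upper: "\<And>\<gamma>. \<gamma> \<in> \<rat> \<Longrightarrow> L < ereal \<gamma> \<Longrightarrow> growth_at_most f \<phi> \<gamma> x"
    and lower: "\<And>\<gamma>. \<gamma> \<in> \<rat> \<Longrightarrow> 0 \<le> \<gamma> \<Longrightarrow> ereal \<gamma> < L \<Longrightarrow> growth_at_least f \<phi> \<gamma> x"
    and lower0: "growth_at_least f \<phi> 0 x"
  shows "(\<lambda>n. ereal (ln (running_max f \<phi> n x) / ln (real n))) \<longlonglongrightarrow> L"
proof -
  let ?q = "\<lambda>n. ln (running_max f \<phi> n x) / ln (real n)"
  have ln_lim: "filterlim (\<lambda>n. ln (real n)) at_top sequentially"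
    by (intro filterlim_compose[OF ln_at_top] filterlim_real_sequentially)
  have lim: "(\<lambda>n. ereal (\<gamma> + ln C / ln (real n))) \<longlonglongrightarrow> ereal \<gamma>" for \<gamma> C
  proof -
    have "(\<lambda>n. \<gamma> + ln C / ln (real n)) \<longlonglongrightarrow> \<gamma> + 0"
      by (intro tendsto_add tendsto_const tendsto_divide_0[OF tendsto_const]
          filterlim_at_top_imp_at_infinity ln_lim)
    then show ?thesis by simp
  qed
  have max_ge: "\<phi> ((f ^^ k) x) \<le> running_max f \<phi> n x" if "k < n" for k n
    unfolding running_max_def using that by (intro Max_ge) auto
  have below: "\<forall>\<^sub>F n in sequentially. a < ereal (?q n)" if a: "a < ereal \<gamma>" and g: "growth_at_least f \<phi> \<gamma> x" for a \<gamma>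
  proof -
    obtain c where c: "c > 0" and ev: "\<forall>\<^sub>F n in sequentially. \<exists>k<n. c * real n powr \<gamma> \<le> \<phi> ((f ^^ k) x)"
      using g unfolding growth_at_least_def by blast
    from ev order_tendstoD(1)[OF lim[of \<gamma> c] a] eventually_gt_at_top[of 1] show ?thesis
    proof eventually_elim
      case (elim n)
      then obtain k where k: "k < n" "c * real n powr \<gamma> \<le> \<phi> ((f ^^ k) x)" by blast
      have m: "c * real n powr \<gamma> \<le> running_max f \<phi> n x" using k(2) max_ge[OF k(1)] by linarith
      have n: "1 < real n" using elim by simp
      have p: "0 < c * real n powr \<gamma>" using c n by simp
      have "ln c + \<gamma> * ln (real n) = ln (c * real n powr \<gamma>)" using c n by (simp add: ln_mult ln_powr)
      also have "\<dots> \<le> ln (running_max f \<phi> n x)"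
        using ln_le_cancel_iff[THEN iffD2, OF p less_le_trans[OF p m] m] .
      finally have "ln c + \<gamma> * ln (real n) \<le> ln (running_max f \<phi> n x)" .
      then have "(ln c + \<gamma> * ln (real n)) / ln (real n) \<le> ?q n"
        using n by (intro divide_right_mono) auto
      then have "\<gamma> + ln c / ln (real n) \<le> ?q n" using n by (simp add: add_divide_distrib)
      then show ?case using elim(2) by (meson ereal_less_eq(3) less_le_trans)
    qed
  qed
  show ?thesis
  proof (rule order_tendstoI)
    fix a assume a: "a < L"
    show "\<forall>\<^sub>F n in sequentially. a < ereal (?q n)"
    proof (cases "a < 0")
      case True
      then show ?thesis using below[of a 0] lower0 by (simp add: zero_ereal_def)
    next
      case False
      obtain r where r: "a < ereal r" "ereal r < L" using ereal_dense2[OF a] by blast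
      obtain r' where r': "ereal r < ereal r'" "ereal r' < L" using ereal_dense2[OF r(2)] by blast
      obtain \<gamma> where \<gamma>: "\<gamma> \<in> \<rat>" "r < \<gamma>" "\<gamma> < r'" using Rats_dense_in_real[of r r'] r' by auto
      have "ereal \<gamma> < L" using \<gamma> r' by (meson ereal_less(2) less_ereal.simps(1) less_trans)
      moreover have "a < ereal \<gamma>" using \<gamma> r by (meson less_ereal.simps(1) less_trans)
      moreover have "0 \<le> \<gamma>" using False \<open>a < ereal \<gamma>\<close>
        by (metis ereal_less_eq(5) le_less_trans less_imp_le not_less)
      ultimately show ?thesis using below lower \<gamma>(1) by blast
    qed
  next
    fix a assume a: "L < a"
    obtain r' where r': "L < ereal r'" "ereal r' < a" using ereal_dense2[OF a] by blast
    obtain r where r: "L < ereal r" "ereal r < ereal r'" using ereal_dense2[OF r'(1)] by blast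
    obtain \<gamma> where \<gamma>: "\<gamma> \<in> \<rat>" "r < \<gamma>" "\<gamma> < r'" using Rats_dense_in_real[of r r'] r by auto
    have "L < ereal \<gamma>" using \<gamma> r by (meson less_ereal.simps(1) less_trans)
    then have "growth_at_most f \<phi> \<gamma> x" using upper \<gamma>(1) by blast
    then obtain C where C: "\<And>k. \<phi> ((f ^^ k) x) \<le> C * real (Suc k) powr \<gamma>"
      unfolding growth_at_most_def by blast
    have "0 < \<gamma>" using L \<open>L < ereal \<gamma>\<close> by (metis ereal_less(2) le_less_trans)
    have \<gamma>a: "ereal \<gamma> < a" using \<gamma> r' by (meson less_ereal.simps(1) less_trans)
    define D where "D = max C 1"
    have D: "D \<ge> 1" "D \<ge> C" by (auto simp: D_def)
    from order_tendstoD(2)[OF lim[of \<gamma> D] \<gamma>a] eventually_gt_at_top[of 1]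
    show "\<forall>\<^sub>F n in sequentially. ereal (?q n) < a"
    proof eventually_elim
      case (elim n)
      have n: "1 < real n" using elim by simp
      have mle: "running_max f \<phi> n x \<le> D * real n powr \<gamma>"
        unfolding running_max_def
      proof (rule Max.boundedI)
        fix y assume "y \<in> (\<lambda>k. \<phi> ((f ^^ k) x)) ` {..<n}"
        then obtain k where k: "k < n" "y = \<phi> ((f ^^ k) x)" by auto
        have "y \<le> C * real (Suc k) powr \<gamma>" using C k by simp
        also have "\<dots> \<le> D * real n powr \<gamma>"
          using D k \<open>0 < \<gamma>\<close> by (intro mult_mono powr_mono2) auto
        finally show "y \<le> D * real n powr \<gamma>" .
      qed (use elim in auto)
      have "ln (running_max f \<phi> n x) \<le> ln D + \<gamma> * ln (real n)"
      proof (cases "running_max f \<phi> n x = 0")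
        case True
        then show ?thesis using D n \<open>0 < \<gamma>\<close> by simp
      next
        case False
        then have p: "0 < running_max f \<phi> n x"
          using max_ge[of 0 n] nonneg[of "(f ^^ 0) x"] elim by simp
        have "ln (running_max f \<phi> n x) \<le> ln (D * real n powr \<gamma>)"
          using ln_le_cancel_iff[THEN iffD2, OF p less_le_trans[OF p mle] mle] .
        also have "\<dots> = ln D + \<gamma> * ln (real n)" using D n by (simp add: ln_mult ln_powr)
        finally show ?thesis .
      qed
      then have "?q n \<le> (ln D + \<gamma> * ln (real n)) / ln (real n)"
        using n by (intro divide_right_mono) auto
      then have "?q n \<le> \<gamma> + ln D / ln (real n)" using n by (simp add: add_divide_distrib)
      then show ?case using elim(1) by (meson ereal_less_eq(3) le_less_trans)
    qed
  qed
qed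


section \<open>The exponent of the running maximum\<close>

theorem corollary2p15:
  fixes M :: "'a::metric_space measure"
    and f :: "'a \<Rightarrow> 'a" and Y :: "'a set" and \<phi> :: "'a \<Rightarrow> real"
    and \<alpha>\<^sub>R \<alpha>\<^sub>\<phi> :: real
  assumes space_M: "space M = UNIV"
    and borel_M: "sets borel \<subseteq> sets M"
    and sigma_finite: "sigma_finite_measure M"
    and infinite: "emeasure M UNIV = \<infinity>"
    and preserving: "measure_preserving_map M f"
    and conservative: "conservative M f"
    and ergodic: "ergodic M f"
    and Y_sets: "Y \<in> sets M"
    and Y_pos: "0 < emeasure M Y"
    and Y_finite: "emeasure M Y < \<infinity>"
    and R_regular: "regular_suplevels (induced_measure M Y) (\<lambda>x. real (return_time f Y x)) \<alpha>\<^sub>R"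
    and decay: "SPDC (induced_measure M Y) (induced_map f Y)"
    and \<phi>_nonneg: "\<And>x. 0 \<le> \<phi> x"
    and \<phi>_unbounded: "\<not> bdd_above (range \<phi>)"
    and \<phi>_bounded_outside: "bdd_above (\<phi> ` (- Y))"
    and \<phi>_regular: "regular_suplevels M \<phi> \<alpha>\<^sub>\<phi>"
    and quotient_defined: "\<not> (\<alpha>\<^sub>R = 0 \<and> \<alpha>\<^sub>\<phi> = 0)"
  shows "AE x in M.
    (\<lambda>n. ereal (ln (running_max f \<phi> n x) / ln (real n))) \<longlonglongrightarrow> ereal \<alpha>\<^sub>R / ereal \<alpha>\<^sub>\<phi>"
proof -
  interpret recurrent_domain M f Y
    using space_M preserving conservative Y_sets Y_pos Y_finite by (rule recurrent_domain.intro)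
  have rd: "recurrent_domain M f Y" by (rule recurrent_domain_axioms)
  note ps = prob_space_induced
  note T = return_map_preserving
  note dec = SPDC_return_map[OF rd borel_M decay]
  have hits: "AE x in \<nu>. \<forall>\<^sub>F n in sequentially. \<exists>j<n. real n powr s \<le> g ((T ^^ j) x)"
    if "asymptotically_regular \<nu> g \<alpha>" "0 \<le> \<alpha>" "0 < s" "s * \<alpha> < 1" for g \<alpha> s
    by (rule suplevels_hit_eventually[OF ps T _ dec that])
      (rule continuous_on_measurable_induced[OF rd borel_M])
  have regR: "asymptotically_regular \<nu> (\<lambda>x. real (R x)) \<alpha>\<^sub>R"
    by (rule regular_suplevels_imp_asymptotically_regular[OF ps R_regular])
  have reg\<phi>: "asymptotically_regular \<nu> \<phi> \<alpha>\<^sub>\<phi>"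
    by (rule asymptotically_regular_induced[OF rd \<phi>_regular \<phi>_bounded_outside])
  have \<alpha>R: "0 \<le> \<alpha>\<^sub>R" "\<alpha>\<^sub>R \<le> 1"
    using regular_suplevelsD(4)[OF R_regular] return_exponent_le_1[OF rd ergodic infinite regR] .
  have \<alpha>\<phi>: "0 \<le> \<alpha>\<^sub>\<phi>" using regular_suplevelsD(4)[OF \<phi>_regular] .
  obtain K where K: "\<And>y. y \<notin> Y \<Longrightarrow> \<phi> y \<le> K"
    using \<phi>_bounded_outside by (auto simp: bdd_above_def)
  have returns_AE: "AE x in \<nu>. always_returns x"
    using AE_induced_returns by eventually_elim (simp add: always_returns_def)
  have Rm: "R \<in> \<nu> \<rightarrow>\<^sub>M count_space UNIV" by (rule measurable_induced[OF return_time_measurable])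
  let ?L = "ereal \<alpha>\<^sub>R / ereal \<alpha>\<^sub>\<phi>"
  have L: "?L = (if \<alpha>\<^sub>\<phi> = 0 then \<infinity> else ereal (\<alpha>\<^sub>R / \<alpha>\<^sub>\<phi>))"
    using \<alpha>R \<alpha>\<phi> quotient_defined by (auto simp: divide_ereal_def divide_inverse)
  have upper: "AE x in M. growth_at_most f \<phi> \<gamma> x" if \<gamma>: "?L < ereal \<gamma>" for \<gamma>
  proof -
    have \<alpha>\<phi>0: "0 < \<alpha>\<^sub>\<phi>" and q: "\<alpha>\<^sub>R / \<alpha>\<^sub>\<phi> < \<gamma>" using \<gamma> L \<alpha>\<phi> by (auto split: if_splits)
    have "0 \<le> \<alpha>\<^sub>R / \<alpha>\<^sub>\<phi>" using \<alpha>R \<alpha>\<phi> by simp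
    then have \<gamma>0: "0 < \<gamma>" using q by linarith
    \<comment> \<open>\<open>\<phi>\<close> grows at most with exponent \<open>s\<close> along the return map, and \<open>S\<^sub>n\<close> at least with exponent
      \<open>s / \<gamma>\<close>; the quotient is \<open>\<gamma>\<close>.\<close>
    obtain s where s: "1 / \<alpha>\<^sub>\<phi> < s" "s * \<alpha>\<^sub>R < \<gamma>"
    proof (cases "\<alpha>\<^sub>R = 0")
      case True
      then show ?thesis using that[of "1 / \<alpha>\<^sub>\<phi> + 1"] \<gamma>0 by simp
    next
      case False
      then have "1 / \<alpha>\<^sub>\<phi> < \<gamma> / \<alpha>\<^sub>R" using q \<alpha>R \<alpha>\<phi>0 by (simp add: field_simps)
      then obtain s where "1 / \<alpha>\<^sub>\<phi> < s" "s < \<gamma> / \<alpha>\<^sub>R" using dense by blast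
      then show ?thesis using that[of s] False \<alpha>R by (simp add: field_simps)
    qed
    have "0 < 1 / \<alpha>\<^sub>\<phi>" using \<alpha>\<phi>0 by simp
    then have s0: "0 < s" using s(1) by linarith
    have s1: "1 < s * \<alpha>\<^sub>\<phi>" using s(1) \<alpha>\<phi>0 by (simp add: field_simps)
    have t: "0 < s / \<gamma>" "s / \<gamma> * \<alpha>\<^sub>R < 1" using s s0 \<gamma>0 by (auto simp: field_simps)
    have "AE x in \<nu>. growth_at_most f \<phi> (s / (s / \<gamma>)) x"
      using returns_AE suplevels_avoided_eventually[OF ps T reg\<phi> s0 s1]
        hits[OF regR \<alpha>R(1) t]
    proof eventually_elim
      case (elim x)
      then show ?case by (intro growth_at_most_of_induced[OF _ K _ _ s0 t(1)])
    qed
    then have "AE x in \<nu>. growth_at_most f \<phi> \<gamma> x" using s0 by simp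
    then show ?thesis using \<gamma>0 by (intro AE_of_induced[OF ergodic]) (auto intro: growth_at_most_funpow)
  qed
  have lower: "AE x in M. growth_at_least f \<phi> \<gamma> x" if \<gamma>: "0 < \<gamma>" "ereal \<gamma> < ?L" for \<gamma>
  proof -
    have q: "\<gamma> * \<alpha>\<^sub>\<phi> < \<alpha>\<^sub>R"
      using \<gamma>(2) L \<alpha>\<phi> \<alpha>R quotient_defined by (auto simp: field_simps split: if_splits)
    have "0 \<le> \<gamma> * \<alpha>\<^sub>\<phi>" using \<gamma>(1) \<alpha>\<phi> by simp
    then have \<alpha>R0: "0 < \<alpha>\<^sub>R" using q by linarith
    \<comment> \<open>Dually, \<open>S\<^sub>n\<close> grows at most with exponent \<open>u\<close> and \<open>\<phi>\<close> at least with exponent \<open>\<gamma> u\<close>.\<close>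
    obtain u where u: "1 / \<alpha>\<^sub>R < u" "\<gamma> * u * \<alpha>\<^sub>\<phi> < 1"
    proof (cases "\<alpha>\<^sub>\<phi> = 0")
      case True
      then show ?thesis using that[of "1 / \<alpha>\<^sub>R + 1"] by simp
    next
      case False
      then have "1 / \<alpha>\<^sub>R < 1 / (\<gamma> * \<alpha>\<^sub>\<phi>)" using q \<gamma>(1) \<alpha>R0 \<alpha>\<phi> by (simp add: field_simps)
      then obtain u where "1 / \<alpha>\<^sub>R < u" "u < 1 / (\<gamma> * \<alpha>\<^sub>\<phi>)" using dense by blast
      then show ?thesis using that[of u] False \<gamma>(1) \<alpha>\<phi> by (simp add: field_simps)
    qed
    have "0 < 1 / \<alpha>\<^sub>R" using \<alpha>R0 by simp
    then have u0: "0 < u" using u(1) by linarith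
    have u1: "1 < u * \<alpha>\<^sub>R" using u(1) \<alpha>R0 by (simp add: field_simps)
    have w: "0 < \<gamma> * u" using \<gamma>(1) u0 by simp
    have "AE x in \<nu>. growth_at_least f \<phi> (\<gamma> * u / u) x"
      using returns_AE hits[OF reg\<phi> \<alpha>\<phi> w u(2)]
        Birkhoff_sum_growth[OF ps T Rm regR \<alpha>R(2) u0 u1]
    proof eventually_elim
      case (elim x)
      then show ?case by (intro growth_at_least_of_induced[OF _ _ _ w u0])
    qed
    then have "AE x in \<nu>. growth_at_least f \<phi> \<gamma> x" using u0 by simp
    then show ?thesis using \<gamma>(1) by (intro AE_of_induced[OF ergodic]) (auto intro: growth_at_least_funpow)
  qed
  have lower0: "AE x in M. growth_at_least f \<phi> 0 x"
  proof -
    have w: "0 < 1 / (\<alpha>\<^sub>\<phi> + 1)" "1 / (\<alpha>\<^sub>\<phi> + 1) * \<alpha>\<^sub>\<phi> < 1" using \<alpha>\<phi> by auto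
    have "AE x in \<nu>. growth_at_least f \<phi> 0 x"
      using returns_AE hits[OF reg\<phi> \<alpha>\<phi> w]
    proof eventually_elim
      case (elim x)
      then show ?case by (intro growth_at_least_0_of_induced[OF _ _ w(1)])
    qed
    then show ?thesis by (intro AE_of_induced[OF ergodic]) (auto intro: growth_at_least_funpow)
  qed
  have "AE x in M. \<forall>\<gamma>\<in>\<rat>. ?L < ereal \<gamma> \<longrightarrow> growth_at_most f \<phi> \<gamma> x"
    using upper by (subst AE_ball_countable[OF countable_rat]) auto
  moreover have "AE x in M. \<forall>\<gamma>\<in>\<rat>. 0 \<le> \<gamma> \<longrightarrow> ereal \<gamma> < ?L \<longrightarrow> growth_at_least f \<phi> \<gamma> x"
  proof (subst AE_ball_countable[OF countable_rat], rule ballI)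
    fix \<gamma> :: real
    show "AE x in M. 0 \<le> \<gamma> \<longrightarrow> ereal \<gamma> < ?L \<longrightarrow> growth_at_least f \<phi> \<gamma> x"
      using lower[of \<gamma>] lower0 by (cases "\<gamma> = 0") auto
  qed
  ultimately show ?thesis using lower0
  proof eventually_elim
    case (elim x)
    show ?case
    proof (rule running_max_exponent[OF \<phi>_nonneg])
      show "0 \<le> ?L" using L \<alpha>R \<alpha>\<phi> by simp
    qed (use elim in auto)
  qed
qed

end
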